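(* Let $Y_\infty=(Y_i)_{i\in\mathbb{Z}}$ be a stationary $\beta$-mixing process with values in $\mathbb{R}^p$ and mixing coefficients $\beta_a$. Let $\mathcal{F}_2$ be the class of steady-state Kalman predictors (defined in the context) with $\lambda_{\max}(T)<1$, and suppose there is $M<\infty$ with $\sqrt{\mathbb{E}[\ell(Y_{k+1}-f(Y_{1:k}))^2]}\le M$ for all $f\in\mathcal{F}_2$ and $k\in\mathbb{N}$. Assume that the loss $\ell$ is a norm on $\mathbb{R}^p$ and let $\ell^*(A)=\sup_{z\ne0}\ell(Az)/\ell(z)$ be the induced matrix norm. Given a time series of length $n$, fix $1\le d<n$ and let $\mu$ and $a>d$ be integers with $2\mu a+d=n$. Then for any $f_2\in\mathcal{F}_2$ and any $\eta>2\mu\beta_{a-d}$, with probability at least $1-\eta$, $$R_n(f_2)\le\widehat{R}_n(f_2)+\delta_d(f_2)+Me^2\sqrt{\frac{\mathcal{E}(4-\log\mathcal{E})}{2}},$$ where $$\mathcal{E}=\frac{4\log G(n,\mathcal{C}_{\ell\circ\mathcal{F}_2'})+4\log(8/\eta')}{\mu},\qquad\eta'=\eta-2\mu\beta_{a-d},$$ $$\delta_d(f_2)=\frac{1}{n-d}\sum_{i=d+1}^n\left[\ell\Big(Y_i-\sum_{j=i-d}^{i-1}s_{ij}Y_j\Big)-\ell\Big(Y_i-\sum_{j=1}^{i-1}s_{ij}Y_j\Big)\right]+\mathbb{E}[\ell(Y_1)]\sum_{j=1}^{n-d}\ell^*(s_{n+1,j}).$$ Furthermore, $\delta_d(f_2)=O_{\mathbb{P}}(\rho^d)$,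 where $\rho=\lambda_{\max}(T-\overline{K}Z)$.
   Context: Notation: $Y_{i:j}=(Y_i,\dots,Y_j)$; stationary means strictly stationary; $\lambda_{\max}(A)$ is the largest absolute value of an eigenvalue of the square matrix $A$. With $\mathbb{P}_0,\mathbb{P}_a,\mathbb{P}_{0\otimes a}$ the restrictions of the law of $Y_\infty$ to $\sigma(Y_{-\infty:0})$, $\sigma(Y_{a:\infty})$, $\sigma(Y_{-\infty:0},Y_{a:\infty})$, $\beta_a=\|\mathbb{P}_0\times\mathbb{P}_a-\mathbb{P}_{0\otimes a}\|_{TV}$ (supremum over events of the absolute difference); $\beta$-mixing means $\beta_a\to0$. $\mathbb{P}$ is the joint law of $Y_{1:n+1}$. $O_{\mathbb{P}}$ denotes stochastic boundedness (as $d\to\infty$, $d<n$). Predictors: the forecasting model is the linear state-space model $Y_i=Z\alpha_i+\epsilon_i$, $\alpha_{i+1}=T\alpha_i+G\eta_{i+1}$, with independent, serially uncorrelated, mean-zero, absolutely continuous noises having $\mathrm{Var}(\epsilon_i)=H$, $\mathrm{Var}(\eta_i)=Q$. The matrices $Z,T,H,G,Q$ may depend on a parameter $\theta$; $H,Q$ are positive definite for all $\theta$. (The data need not follow this model.) For each $\theta$ let $\overline{P}$ be the solution of the Riccati equation $P=TPT^\top-TPZ^\top(ZPZ^\top+H)^{-1}ZPT^\top+GQG^\top$ and $\overline{K}=T\overline{P}Z^\top(Z\overline{P}Z^\top+H)^{-1}$. The predictor $f_2\in\mathcal{F}_2$ for this $\theta$ predicts $Y_i$ by $f_2(Y_{1:i-1})=\sum_{j=1}^{i-1}s_{ij}Y_j$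 with $s_{ij}=s_{i-j-1}=Z(T-\overline{K}Z)^{i-j-1}\overline{K}$ for $i>j$ (and $0$ otherwise). The truncated class $\mathcal{F}_2'$ consists of the fixed-memory predictors $f_2'(Y_{1:i-1})=\sum_{j=i-d}^{i-1}s_{ij}Y_j$, regarded as maps $\mathbb{R}^{d\times p}\to\mathbb{R}^p$. Risk: $R_n(f)=\mathbb{E}[\ell(Y_{n+1}-f(Y_{1:n}))]$; training error: $\widehat{R}_n(f)=\frac{1}{n-d}\sum_{i=d+1}^n\ell(Y_i-f(Y_{1:i-1}))$ with the chosen $d$. Growth function: for a collection $\mathcal{C}$ of subsets of a set $\mathbb{V}$, $G(n,\mathcal{C})=\sup_{S\subset\mathbb{V},|S|=n}|\{S\cap C:C\in\mathcal{C}\}|$ (not to be confused with the matrix $G$). $\mathcal{C}_{\ell\circ\mathcal{F}}=\{C_{\ell\circ f}:f\in\mathcal{F}\}$ with $C_{\ell\circ f}=\{(u,u_0,u_0')\in\mathbb{U}\times\mathbb{R}^p\times\mathbb{R}:\ell(u_0-f(u))-u_0'\ge0\}$, here $\mathbb{U}=\mathbb{R}^{d\times p}$.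
   Formalization: The risk bound is stated for 4−log 𝓔 ≥ e^{-4} (it fails at 𝓔=e^4); δ_d=O_P(ρ^d) is stated when the eigenvalues of T−K̄Z of maximal modulus are semisimple (it can fail otherwise), and δ_d=O_P(d^{m−1}ρ^d), m the state dimension, always; E[ℓ(Y_1)]<∞ is assumed. *)

theory Defs
  imports "HOL-Probability.Probability"
begin

section \<open>Stationarity and beta-mixing\<close>

definition path_space :: "int set \<Rightarrow> (int \<Rightarrow> 'v::topological_space) measure" where
  "path_space I = (\<Pi>\<^sub>M i\<in>I. borel)"

definition law_on ::
  "'w measure \<Rightarrow> (int \<Rightarrow> 'w \<Rightarrow> 'v::topological_space) \<Rightarrow> int set \<Rightarrow> (int \<Rightarrow> 'v) measure" where
  "law_on \<Omega> Y I = distr \<Omega> (path_space I) (\<lambda>\<omega>. \<lambda>i\<in>I. Y i \<omega>)"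

definition stationary :: "'w measure \<Rightarrow> (int \<Rightarrow> 'w \<Rightarrow> 'v::topological_space) \<Rightarrow> bool" where
  "stationary \<Omega> Y \<longleftrightarrow> (\<forall>h. law_on \<Omega> (\<lambda>i. Y (i + h)) UNIV = law_on \<Omega> Y UNIV)"

text \<open>Events of the sigma-algebra generated by past and future are represented by measurable
  subsets of the product of the two path spaces, so that both measures in the total variation
  distance live on the same space.\<close>

definition joint_law_past_future ::
  "'w measure \<Rightarrow> (int \<Rightarrow> 'w \<Rightarrow> 'v::topological_space) \<Rightarrow> nat \<Rightarrow> ((int \<Rightarrow> 'v) \<times> (int \<Rightarrow> 'v)) measure" where
  "joint_law_past_future \<Omega> Y a =
     distr \<Omega> (path_space {..0} \<Otimes>\<^sub>M path_space {int a..})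
       (\<lambda>\<omega>. (\<lambda>i\<in>{..0}. Y i \<omega>, \<lambda>i\<in>{int a..}. Y i \<omega>))"

definition tv_dist :: "'b measure \<Rightarrow> 'b measure \<Rightarrow> real" where
  "tv_dist \<mu> \<nu> = (SUP A\<in>sets \<mu>. \<bar>measure \<mu> A - measure \<nu> A\<bar>)"

definition beta_coeff ::
  "'w measure \<Rightarrow> (int \<Rightarrow> 'w \<Rightarrow> 'v::topological_space) \<Rightarrow> nat \<Rightarrow> real" where
  "beta_coeff \<Omega> Y a =
     tv_dist (law_on \<Omega> Y {..0} \<Otimes>\<^sub>M law_on \<Omega> Y {int a..}) (joint_law_past_future \<Omega> Y a)"

definition beta_mixing :: "'w measure \<Rightarrow> (int \<Rightarrow> 'w \<Rightarrow> 'v::topological_space) \<Rightarrow> bool" where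
  "beta_mixing \<Omega> Y \<longleftrightarrow> beta_coeff \<Omega> Y \<longlonglongrightarrow> 0"

section \<open>Matrices and norms\<close>

text \<open>The power operation of the type of vectors is componentwise, hence the iteration below.\<close>

definition matrix_power :: "real^'n^'n \<Rightarrow> nat \<Rightarrow> real^'n^'n" where
  "matrix_power A k = (((**) A) ^^ k) (mat 1)"

definition complex_matrix :: "real^'n^'m \<Rightarrow> complex^'n^'m" where
  "complex_matrix A = (\<chi> i j. complex_of_real (A $ i $ j))"

definition eigenvalues :: "real^'n^'n \<Rightarrow> complex set" where
  "eigenvalues A = {ev. \<exists>v. v \<noteq> 0 \<and> complex_matrix A *v v = ev *s v}"

definition lambda_max :: "real^'n^'n \<Rightarrow> real" where
  "lambda_max A = Max (cmod ` eigenvalues A)"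

text \<open>No eigenvalue of maximal modulus has a nontrivial Jordan block; this holds in particular
  for diagonalizable matrices. Without it the powers of \<open>A\<close> are \<open>O(k^(m-1) * lambda_max A ^ k)\<close>,
  with \<open>m\<close> the size of \<open>A\<close>, but in general not \<open>O(lambda_max A ^ k)\<close>.\<close>

definition dominant_semisimple :: "real^'n^'n \<Rightarrow> bool" where
  "dominant_semisimple A \<longleftrightarrow>
     (\<forall>ev v. cmod ev = lambda_max A \<longrightarrow>
        (complex_matrix A - mat ev) *v ((complex_matrix A - mat ev) *v v) = 0 \<longrightarrow>
        (complex_matrix A - mat ev) *v v = 0)"

definition pos_def :: "real^'n^'n \<Rightarrow> bool" where
  "pos_def A \<longleftrightarrow> transpose A = A \<and> (\<forall>x. x \<noteq> 0 \<longrightarrow> 0 < x \<bullet> (A *v x))"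

definition pos_semidef :: "real^'n^'n \<Rightarrow> bool" where
  "pos_semidef A \<longleftrightarrow> transpose A = A \<and> (\<forall>x. 0 \<le> x \<bullet> (A *v x))"

definition is_norm :: "('v::real_vector \<Rightarrow> real) \<Rightarrow> bool" where
  "is_norm l \<longleftrightarrow> (\<forall>x. 0 \<le> l x) \<and> (\<forall>x. l x = 0 \<longleftrightarrow> x = 0) \<and> (\<forall>c x. l (c *\<^sub>R x) = \<bar>c\<bar> * l x) \<and>
     (\<forall>x y. l (x + y) \<le> l x + l y)"

definition induced_norm :: "(real^'p \<Rightarrow> real) \<Rightarrow> real^'p^'p \<Rightarrow> real" where
  "induced_norm l A = (SUP z\<in>UNIV - {0}. l (A *v z) / l z)"

section \<open>Steady-state Kalman predictors\<close>

text \<open>State dimension \<open>'m\<close>, observation dimension \<open>'p\<close>, state noise dimension \<open>'r\<close>. The noises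
  themselves enter the predictors only through their covariance matrices.\<close>

record ('m, 'p, 'r) state_space =
  obs_mat :: "real^'m^'p"
  trans_mat :: "real^'m^'m"
  noise_mat :: "real^'r^'m"
  obs_cov :: "real^'p^'p"
  state_cov :: "real^'r^'r"

text \<open>\<open>P\<close> is a covariance matrix, so the solution of the Riccati equation that is meant is the
  positive semidefinite one. It exists and is unique for stable \<open>trans_mat S\<close> and positive
  definite \<open>obs_cov S\<close> and \<open>state_cov S\<close>.\<close>

definition riccati_solution ::
  "('m::finite, 'p::finite, 'r::finite) state_space \<Rightarrow> real^'m^'m \<Rightarrow> bool" where
  "riccati_solution S P \<longleftrightarrow> pos_semidef P \<and>
     (let Z = obs_mat S; T = trans_mat S; G = noise_mat S; H = obs_cov S; Q = state_cov S in
       P = T ** P ** transpose T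
         - T ** P ** transpose Z ** matrix_inv (Z ** P ** transpose Z + H)
             ** Z ** P ** transpose T
         + G ** Q ** transpose G)"

definition kalman_gain ::
  "('m::finite, 'p::finite, 'r::finite) state_space \<Rightarrow> real^'m^'m \<Rightarrow> real^'p^'m" where
  "kalman_gain S P =
     trans_mat S ** P ** transpose (obs_mat S)
       ** matrix_inv (obs_mat S ** P ** transpose (obs_mat S) + obs_cov S)"

definition closed_loop ::
  "('m::finite, 'p::finite, 'r::finite) state_space \<Rightarrow> real^'m^'m \<Rightarrow> real^'m^'m" where
  "closed_loop S P = trans_mat S - kalman_gain S P ** obs_mat S"

definition kalman_coeff ::
  "('m::finite, 'p::finite, 'r::finite) state_space \<Rightarrow> real^'m^'m \<Rightarrow> nat \<Rightarrow> nat \<Rightarrow> real^'p^'p" where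
  "kalman_coeff S P i j =
     (if j < i then obs_mat S ** matrix_power (closed_loop S P) (i - j - 1) ** kalman_gain S P
      else 0)"

text \<open>A predictor with growing memory maps \<open>k\<close> and a sequence \<open>y\<close> to the prediction of \<open>y (k + 1)\<close>
  from \<open>y 1, \<dots>, y k\<close>.\<close>

type_synonym 'p predictor = "nat \<Rightarrow> (nat \<Rightarrow> real^'p) \<Rightarrow> real^'p"

definition kalman_predictor ::
  "('m::finite, 'p::finite, 'r::finite) state_space \<Rightarrow> real^'m^'m \<Rightarrow> 'p predictor" where
  "kalman_predictor S P k y = (\<Sum>j=1..k. kalman_coeff S P (k + 1) j *v y j)"

text \<open>The truncated predictor as a function of a window \<open>u 1, \<dots>, u d\<close>, where \<open>u d\<close> is the most
  recent observation; since \<open>kalman_coeff S P i j\<close> depends only on \<open>i - j\<close>, the coefficients do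
  not depend on the position of the window.\<close>

definition truncated_predictor ::
  "('m::finite, 'p::finite, 'r::finite) state_space \<Rightarrow> real^'m^'m \<Rightarrow> nat
    \<Rightarrow> (nat \<Rightarrow> real^'p) \<Rightarrow> real^'p" where
  "truncated_predictor S P d u = (\<Sum>j=1..d. kalman_coeff S P (d + 1) j *v u j)"

definition stable_params ::
  "'t set \<Rightarrow> ('t \<Rightarrow> ('m::finite, 'p::finite, 'r::finite) state_space) \<Rightarrow> 't set" where
  "stable_params \<Theta> S = {\<theta>\<in>\<Theta>. lambda_max (trans_mat (S \<theta>)) < 1}"

definition kalman_class ::
  "'t set \<Rightarrow> ('t \<Rightarrow> ('m::finite, 'p::finite, 'r::finite) state_space) \<Rightarrow> ('t \<Rightarrow> real^'m^'m)
    \<Rightarrow> 'p predictor set" where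
  "kalman_class \<Theta> S P = (\<lambda>\<theta>. kalman_predictor (S \<theta>) (P \<theta>)) ` stable_params \<Theta> S"

definition truncated_class ::
  "'t set \<Rightarrow> ('t \<Rightarrow> ('m::finite, 'p::finite, 'r::finite) state_space) \<Rightarrow> ('t \<Rightarrow> real^'m^'m)
    \<Rightarrow> nat \<Rightarrow> ((nat \<Rightarrow> real^'p) \<Rightarrow> real^'p) set" where
  "truncated_class \<Theta> S P d = (\<lambda>\<theta>. truncated_predictor (S \<theta>) (P \<theta>) d) ` stable_params \<Theta> S"

section \<open>Risk, training error and complexity\<close>

definition loss_at ::
  "(real^'p \<Rightarrow> real) \<Rightarrow> (int \<Rightarrow> 'w \<Rightarrow> real^'p) \<Rightarrow> 'p predictor \<Rightarrow> nat \<Rightarrow> 'w \<Rightarrow> real" where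
  "loss_at l Y f k \<omega> = l (Y (int (k + 1)) \<omega> - f k (\<lambda>j. Y (int j) \<omega>))"

definition risk ::
  "'w measure \<Rightarrow> (real^'p \<Rightarrow> real) \<Rightarrow> (int \<Rightarrow> 'w \<Rightarrow> real^'p) \<Rightarrow> nat \<Rightarrow> 'p predictor \<Rightarrow> real" where
  "risk \<Omega> l Y n f = (\<integral>\<omega>. loss_at l Y f n \<omega> \<partial>\<Omega>)"

definition training_error ::
  "(real^'p \<Rightarrow> real) \<Rightarrow> (int \<Rightarrow> 'w \<Rightarrow> real^'p) \<Rightarrow> nat \<Rightarrow> nat \<Rightarrow> 'p predictor \<Rightarrow> 'w \<Rightarrow> real" where
  "training_error l Y d n f \<omega> =
     1 / real (n - d) * (\<Sum>i=d+1..n. loss_at l Y f (i - 1) \<omega>)"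

definition growth_function :: "nat \<Rightarrow> 'v set \<Rightarrow> 'v set set \<Rightarrow> nat" where
  "growth_function n V \<C> =
     (SUP A\<in>{A. A \<subseteq> V \<and> finite A \<and> card A = n}. card {A \<inter> C |C. C \<in> \<C>})"

text \<open>The space of windows is encoded by the extensional functions on \<open>{1..d}\<close>, so that distinct
  elements are distinct points of the \<open>d\<close>-fold product.\<close>

definition windows :: "nat \<Rightarrow> (nat \<Rightarrow> real^'p) set" where
  "windows d = {1..d} \<rightarrow>\<^sub>E UNIV"

definition loss_subgraph ::
  "(real^'p \<Rightarrow> real) \<Rightarrow> nat \<Rightarrow> ((nat \<Rightarrow> real^'p) \<Rightarrow> real^'p)
    \<Rightarrow> ((nat \<Rightarrow> real^'p) \<times> (real^'p) \<times> real) set" where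
  "loss_subgraph l d f = {(u, u0, u0'). u \<in> windows d \<and> l (u0 - f u) - u0' \<ge> 0}"

definition loss_growth ::
  "(real^'p \<Rightarrow> real) \<Rightarrow> nat \<Rightarrow> ((nat \<Rightarrow> real^'p) \<Rightarrow> real^'p) set \<Rightarrow> nat \<Rightarrow> nat" where
  "loss_growth l d F n =
     growth_function n (windows d \<times> UNIV \<times> UNIV) (loss_subgraph l d ` F)"

text \<open>The deviation bound contains the square root of \<open>E * (4 - ln E)\<close>, which is real only for
  \<open>4 - ln E \<ge> 0\<close> and drops to \<open>0\<close> at \<open>E = exp 4\<close>, where the bound fails already for constant predictors
  of independent data. It is used for \<open>4 - ln E \<ge> exp (- 4)\<close>.\<close>

definition complexity_term :: "nat \<Rightarrow> nat \<Rightarrow> real \<Rightarrow> real" where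
  "complexity_term g \<mu> \<eta>' = (4 * ln (real g) + 4 * ln (8 / \<eta>')) / real \<mu>"

definition truncation_gap ::
  "'w measure \<Rightarrow> (real^'p \<Rightarrow> real) \<Rightarrow> (int \<Rightarrow> 'w \<Rightarrow> real^'p)
    \<Rightarrow> ('m::finite, 'p::finite, 'r::finite) state_space \<Rightarrow> real^'m^'m
    \<Rightarrow> nat \<Rightarrow> nat \<Rightarrow> 'w \<Rightarrow> real" where
  "truncation_gap \<Omega> l Y S P d n \<omega> =
     1 / real (n - d) *
       (\<Sum>i=d+1..n.
          l (Y (int i) \<omega> - (\<Sum>j=i-d..i-1. kalman_coeff S P i j *v Y (int j) \<omega>))
        - l (Y (int i) \<omega> - (\<Sum>j=1..i-1. kalman_coeff S P i j *v Y (int j) \<omega>)))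
     + (\<integral>\<omega>'. l (Y 1 \<omega>') \<partial>\<Omega>) *
       (\<Sum>j=1..n-d. induced_norm l (kalman_coeff S P (n + 1) j))"

text \<open>Stochastic boundedness of \<open>X d n / r d\<close> as \<open>d\<close> tends to infinity, uniformly in \<open>n > d\<close>.\<close>

definition bigO_prob :: "'w measure \<Rightarrow> (nat \<Rightarrow> nat \<Rightarrow> 'w \<Rightarrow> real) \<Rightarrow> (nat \<Rightarrow> real) \<Rightarrow> bool" where
  "bigO_prob \<Omega> X r \<longleftrightarrow>
     (\<forall>\<epsilon>>0. \<exists>C. \<exists>d0. \<forall>d n. d0 \<le> d \<and> d < n \<longrightarrow>
        measure \<Omega> {\<omega>\<in>space \<Omega>. \<bar>X d n \<omega>\<bar> > C * \<bar>r d\<bar>} < \<epsilon>)"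

end

theory Submission
  imports Defs "HOL-Computational_Algebra.Fundamental_Theorem_Algebra"
begin

text \<open>The predictor \<open>f\<close> is fixed before the data are seen, so the theorem concerns the deviation of one
  empirical mean. Let \<open>X i\<close> (below: \<open>window_at i\<close>) be the loss at time \<open>i\<close> of the predictor
  truncated to memory \<open>d\<close>. The training
  error plus the truncation gap is the average of \<open>X (d + 1), \<dots>, X n\<close> plus a constant
  (\<open>training_error_plus_gap\<close>), and by the triangle inequality and stationarity the risk is at most
  the mean of \<open>X\<close> plus the same constant (\<open>risk_le_truncated_risk\<close>). It remains to bound the
  probability that the average of the \<open>X i\<close> lies below their common mean by more than
  \<open>\<tau> = M * (exp 1)\<^sup>2 * sqrt (E * (4 - ln E) / 2)\<close>.

  The \<open>X i\<close> are nonnegative with second moment at most \<open>M\<^sup>2\<close>, and for such variables the lower tail is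
  sub-Gaussian whatever the upper tail looks like: \<open>exp (- x) \<le> 1 - x + x\<^sup>2 / 2\<close> for \<open>x \<ge> 0\<close> bounds the
  Laplace transform. Independence is imitated by cutting the times into \<open>2 * \<mu>\<close> blocks of length \<open>a\<close>.
  Two successive blocks of equal parity look at data that are more than \<open>a - d\<close> apart, so treating a block as
  independent of its predecessors costs \<open>beta_coeff \<Omega> Y (a - d)\<close> (\<open>decoupling_blocks\<close>). For each
  parity the Chernoff bound gives \<open>exp (- \<mu> * \<tau>\<^sup>2 / (2 * M\<^sup>2)) + \<mu> * beta_coeff \<Omega> Y (a - d)\<close>
  (\<open>lower_tail_alternate_blocks\<close>). The factor \<open>(exp 1)\<^sup>2\<close> in \<open>\<tau>\<close> and \<open>4 - ln E \<ge> exp (- 4)\<close> give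
  \<open>\<tau>\<^sup>2 \<ge> M\<^sup>2 * E / 2\<close>, and since a growth function is at least \<open>1\<close> the exponential is at most \<open>\<eta>' / 8\<close>
  (\<open>deviation_tail_le\<close>).

  For the rate, both parts of the truncation gap have absolute mean at most \<open>E[l (Y 1)]\<close> times the tail
  \<open>\<Sum>k\<ge>d. l\<^sup>*(Z A\<^sup>k K)\<close>, where \<open>A\<close> is the closed loop matrix \<open>T - K Z\<close> and \<open>l\<^sup>*\<close> the induced norm, and
  Markov's inequality applies (\<open>truncation_gap_bigO\<close>). The Riccati equation in Joseph form shows that
  all eigenvalues of \<open>A\<close> lie inside the unit disc (\<open>closed_loop_stable\<close>). The growth of \<open>A\<^sup>k\<close> follows
  from the fact that every vector is annihilated by a product of at most \<open>m\<close> factors \<open>A - x\<close> with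
  eigenvalues \<open>x\<close>: each factor after the first contributes at most one power of \<open>k\<close> (\<open>matrix_power_bound\<close>), and none
  if the dominant eigenvalues are semisimple (\<open>matrix_power_bound_semisimple\<close>).\<close>

section \<open>Growth of the powers of a matrix\<close>

text \<open>The product of the commuting factors \<open>A - x\<close>, \<open>x\<close> in the list, applied to a vector. Lists, rather than
  a polynomial in \<open>A\<close>, make induction over single factors possible.\<close>

primrec shift_prod :: "complex^'n^'n \<Rightarrow> complex list \<Rightarrow> complex^'n \<Rightarrow> complex^'n" where
  "shift_prod A [] v = v"
| "shift_prod A (x # xs) v = shift_prod A xs (A *v v - x *s v)"

lemma shift_prod_add: "shift_prod A xs (u + v) = shift_prod A xs u + shift_prod A xs v"
  by (induction xs arbitrary: u v)
     (simp_all add: matrix_vector_right_distrib vec.scale_right_distrib add_diff_add)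

lemma shift_prod_scale: "shift_prod A xs (c *s v) = c *s shift_prod A xs v"
proof (induction xs arbitrary: v)
  case (Cons x xs)
  have "A *v (c *s v) - x *s (c *s v) = c *s (A *v v - x *s v)"
    by (simp add: vec.scale_right_diff_distrib vec.scale mult.commute)
  then show ?case
    by (simp only: shift_prod.simps Cons.IH)
qed simp

lemma shift_prod_zero [simp]: "shift_prod A xs 0 = 0"
  using shift_prod_scale[of A xs 0 0] by simp

lemma shift_prod_diff: "shift_prod A xs (u - v) = shift_prod A xs u - shift_prod A xs v"
  using shift_prod_add[of A xs "u - v" v] by simp

lemma shift_prod_mult: "shift_prod A xs (A *v v) = A *v shift_prod A xs v"
proof (induction xs arbitrary: v)
  case (Cons x xs)
  have "A *v (A *v v) - x *s (A *v v) = A *v (A *v v - x *s v)"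
    by (simp add: vec.scale vec.diff)
  then show ?case
    by (simp only: shift_prod.simps Cons.IH)
qed simp

lemma shift_prod_append: "shift_prod A (xs @ ys) v = shift_prod A ys (shift_prod A xs v)"
  by (induction xs arbitrary: v) simp_all

text \<open>The factors commute, so that any one of them can be applied last.\<close>

lemma shift_prod_middle:
  "shift_prod A (xs @ x # ys) v = (let u = shift_prod A (xs @ ys) v in A *v u - x *s u)"
  by (simp add: shift_prod_append shift_prod_diff shift_prod_scale shift_prod_mult Let_def)

lemma shift_prod_eigenvector:
  assumes "A *v v = x *s v"
  shows "shift_prod A xs v = (\<Prod>y\<leftarrow>xs. x - y) *s v"
proof (induction xs)
  case (Cons y xs)
  have "A *v v - y *s v = (x - y) *s v"
    by (simp add: assms vec.scale_left_diff_distrib)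
  then show ?case
    by (simp only: shift_prod.simps shift_prod_scale Cons.IH list.map prod_list.Cons)
      (simp add: vec.scale_scale)
qed simp

lemma shift_prod_zeros: "set xs \<subseteq> {0} \<Longrightarrow> shift_prod A xs v = ((*v) A ^^ length xs) v"
  by (induction xs arbitrary: v) (simp_all add: funpow_swap1)

text \<open>The action \<open>p(A) v\<close> of a polynomial; it links \<open>shift_prod\<close> to the fundamental theorem of algebra.\<close>

definition poly_apply :: "complex^'n^'n \<Rightarrow> complex poly \<Rightarrow> complex^'n \<Rightarrow> complex^'n" where
  "poly_apply A p v = (\<Sum>i\<le>degree p. coeff p i *s ((*v) A ^^ i) v)"

lemma poly_apply_eq_sum:
  assumes "degree p \<le> N"
  shows "poly_apply A p v = (\<Sum>i\<le>N. coeff p i *s ((*v) A ^^ i) v)"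
  unfolding poly_apply_def
  using assms by (intro sum.mono_neutral_left) (auto simp: coeff_eq_0)

lemma poly_apply_linear_factor:
  "poly_apply A ([:-x, 1:] * q) v = poly_apply A q (A *v v - x *s v)"
proof -
  define D where "D = degree q"
  have pw_add: "((*v) A ^^ i) (u + w) = ((*v) A ^^ i) u + ((*v) A ^^ i) w"
    and pw_scale: "((*v) A ^^ i) (c *s u) = c *s ((*v) A ^^ i) u" for i c u w
    by (induction i) (simp_all add: vec.scale matrix_vector_right_distrib)
  have pw_diff: "((*v) A ^^ i) (u - w) = ((*v) A ^^ i) u - ((*v) A ^^ i) w" for i u w
    using pw_add[of i "u - w" w] by simp
  have eq: "[:-x, 1:] * q = pCons 0 q - smult x q"
    by simp
  have deg: "degree (pCons 0 q - smult x q) \<le> Suc D"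
    by (intro degree_diff_le) (auto simp: D_def degree_pCons_le le_SucI)
  have "poly_apply A ([:-x, 1:] * q) v =
      (\<Sum>i\<le>Suc D. coeff (pCons 0 q) i *s ((*v) A ^^ i) v)
      - x *s (\<Sum>i\<le>Suc D. coeff q i *s ((*v) A ^^ i) v)"
    unfolding eq poly_apply_eq_sum[OF deg]
    by (simp add: vec.scale_left_diff_distrib sum_subtractf vec.scale_sum_right del: sum.atMost_Suc)
  also have "(\<Sum>i\<le>Suc D. coeff (pCons 0 q) i *s ((*v) A ^^ i) v) = poly_apply A q (A *v v)"
    by (subst sum.atMost_Suc_shift) (simp add: poly_apply_def D_def funpow_swap1)
  also have "(\<Sum>i\<le>Suc D. coeff q i *s ((*v) A ^^ i) v) = poly_apply A q v"
    by (rule poly_apply_eq_sum[symmetric]) (simp add: D_def)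
  also have "poly_apply A q (A *v v) - x *s poly_apply A q v = poly_apply A q (A *v v - x *s v)"
    by (simp add: poly_apply_def pw_diff pw_scale vec.scale_right_diff_distrib sum_subtractf
        vec.scale_sum_right mult.commute)
  finally show ?thesis .
qed

lemma poly_apply_prod:
  "poly_apply A (smult c (\<Prod>x\<leftarrow>xs. [:-x, 1:])) v = c *s shift_prod A xs v"
proof (induction xs arbitrary: v)
  case Nil
  then show ?case
    by (simp add: poly_apply_def)
next
  case (Cons x xs)
  have "smult c (\<Prod>x\<leftarrow>x # xs. [:-x, 1:]) = [:-x, 1:] * smult c (\<Prod>x\<leftarrow>xs. [:-x, 1:])"
    by (simp only: list.map prod_list.Cons mult_smult_right)
  then show ?case
    by (simp only: poly_apply_linear_factor Cons.IH shift_prod.simps)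
qed

text \<open>The \<open>m + 1\<close> vectors \<open>v, A v, \<dots>, A\<^sup>m v\<close> are linearly dependent in dimension \<open>m\<close>.\<close>

lemma exists_annihilating_poly:
  fixes A :: "complex^'n^'n"
  shows "\<exists>p. p \<noteq> 0 \<and> degree p \<le> CARD('n) \<and> poly_apply A p v = 0"
proof -
  define f where "f i = ((*v) A ^^ i) v" for i
  let ?N = "CARD('n)"
  have "\<exists>c. (\<exists>i\<le>?N. c i \<noteq> 0) \<and> (\<Sum>i\<le>?N. c i *s f i) = 0"
  proof (cases "inj_on f {..?N}")
    case False
    then obtain i j where ij: "i \<le> ?N" "j \<le> ?N" "i \<noteq> j" "f i = f j"
      by (auto simp: inj_on_def)
    \<comment> \<open>A repetition among the powers is itself a linear relation.\<close>
    let ?c = "\<lambda>k. (if k = i then 1 else 0) - (if k = j then 1 else 0 :: complex)"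
    have "(\<Sum>k\<le>?N. ?c k *s f k) = f i - f j"
      using ij by (simp add: vec.scale_left_diff_distrib sum_subtractf if_distrib[of "\<lambda>c. c *s _"]
          sum.delta cong: if_cong)
    then show ?thesis
      using ij by (intro exI[of _ ?c]) auto
  next
    case True
    have "card (f ` {..?N}) > vec.dim (f ` {..?N})"
      using vec.dim_subset_UNIV[of "f ` {..?N}"] card_image[OF True]
      by (simp add: vec.dimension_def card_cart_basis)
    then have "vec.dependent (f ` {..?N})"
      using vec.dependent_biggerset_general by blast
    then obtain u where u: "\<exists>x\<in>f ` {..?N}. u x \<noteq> 0" "(\<Sum>x\<in>f ` {..?N}. u x *s x) = 0"
      by (subst (asm) vec.dependent_finite) auto
    then show ?thesis
      by (intro exI[of _ "\<lambda>i. u (f i)"]) (auto simp: sum.reindex[OF True] o_def)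
  qed
  then obtain c i where c: "i \<le> ?N" "c i \<noteq> 0" "(\<Sum>i\<le>?N. c i *s f i) = 0"
    by blast
  define p where "p = (\<Sum>i\<le>?N. monom (c i) i)"
  have co: "coeff p k = (if k \<le> ?N then c k else 0)" for k
    by (simp add: p_def coeff_sum coeff_monom sum.delta)
  have deg: "degree p \<le> ?N"
    by (rule degree_le) (simp add: co)
  have "p \<noteq> 0"
    using c co by (metis coeff_0)
  moreover have "poly_apply A p v = 0"
    using c(3) by (simp add: poly_apply_eq_sum[OF deg] co f_def)
  ultimately show ?thesis
    using deg by blast
qed

text \<open>Factor an annihilating polynomial of \<open>v\<close> over the complex numbers and pass to a shortest list of
  roots that still annihilates \<open>v\<close>. Dropping any factor \<open>A - x\<close> of it leaves a nonzero vector, which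
  \<open>A - x\<close> kills; hence all members of the list are eigenvalues. This replaces the Jordan normal form.\<close>

lemma exists_annihilating_eigenvalues:
  fixes A :: "real^'n^'n"
  shows "\<exists>xs. set xs \<subseteq> eigenvalues A \<and> length xs \<le> CARD('n)
    \<and> shift_prod (complex_matrix A) xs v = 0"
proof -
  let ?A = "complex_matrix A"
  obtain p where p: "p \<noteq> 0" "degree p \<le> CARD('n)" "poly_apply ?A p v = 0"
    using exists_annihilating_poly by blast
  obtain ys where ys: "mset ys = proots p"
    using ex_mset by blast
  have "p = smult (lead_coeff p) (\<Prod>x\<leftarrow>ys. [:-x, 1:])"
    using complex_poly_decompose_multiset[of p] ys
    by (metis mset_map prod_mset_prod_list)
  then have "lead_coeff p *s shift_prod ?A ys v = 0"
    using p(3) poly_apply_prod by metis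
  then have ys0: "shift_prod ?A ys v = 0"
    using p(1) by (simp add: vec.scale_eq_0_iff)
  have len: "length ys \<le> CARD('n)"
    using p(2) ys size_proots_complex[of p] by (metis size_mset)
  obtain xs where xs: "shift_prod ?A xs v = 0"
    and least: "\<And>zs. shift_prod ?A zs v = 0 \<Longrightarrow> length xs \<le> length zs"
    using ys0 ex_has_least_nat[of "\<lambda>xs. shift_prod ?A xs v = 0" ys length] by blast
  have "x \<in> eigenvalues A" if x: "x \<in> set xs" for x
  proof -
    obtain as bs where ab: "xs = as @ x # bs"
      using split_list[OF x] by blast
    define u where "u = shift_prod ?A (as @ bs) v"
    have "u \<noteq> 0"
      using least[of "as @ bs"] by (auto simp: ab u_def)
    moreover have "?A *v u = x *s u"
      using xs by (simp add: ab shift_prod_middle u_def[symmetric])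
    ultimately show ?thesis
      by (auto simp: eigenvalues_def)
  qed
  then show ?thesis
    using xs least[OF ys0] len by (intro exI[of _ xs]) auto
qed

text \<open>Finiteness and nonemptiness make the maximum in the definition of \<open>lambda_max\<close> meaningful. One
  list of eigenvalues annihilates a basis and hence every eigenvector, which leaves no room for others.\<close>

lemma finite_eigenvalues: "finite (eigenvalues A)"
  and eigenvalues_nonempty: "eigenvalues A \<noteq> {}"
  for A :: "real^'n^'n"
proof -
  let ?A = "complex_matrix A"
  have "\<exists>xs. \<forall>i. shift_prod ?A (xs i) (axis i 1) = 0 \<and> set (xs i) \<subseteq> eigenvalues A"
    using exists_annihilating_eigenvalues[of A] by (intro choice allI) blast
  then obtain xs where xs: "\<And>i. shift_prod ?A (xs i) (axis i 1) = 0"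
      "\<And>i. set (xs i) \<subseteq> eigenvalues A"
    by blast
  have sum: "shift_prod ?A zs (\<Sum>i\<in>I. f i) = (\<Sum>i\<in>I. shift_prod ?A zs (f i))" if "finite I"
    for zs f and I :: "'n set"
    using that by induction (simp_all add: shift_prod_add)
  obtain js :: "'n list" where js: "set js = UNIV"
    using finite_list[OF finite[of UNIV]] by blast
  have all: "shift_prod ?A (concat (map xs js)) (axis i 1) = 0" for i
  proof -
    obtain as bs where "js = as @ i # bs"
      using js by (metis UNIV_I split_list)
    moreover have comm: "shift_prod ?A us (shift_prod ?A zs v) = shift_prod ?A zs (shift_prod ?A us v)"
      for us zs v
      by (induction us arbitrary: v)
        (simp_all add: shift_prod_diff shift_prod_scale shift_prod_mult)
    ultimately show ?thesis
      by (simp add: shift_prod_append comm[of "xs i"] xs)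
  qed
  have "eigenvalues A \<subseteq> set (concat (map xs js))"
  proof
    fix x assume "x \<in> eigenvalues A"
    then obtain v where v: "v \<noteq> 0" "?A *v v = x *s v"
      by (auto simp: eigenvalues_def)
    have "shift_prod ?A (concat (map xs js)) v
        = shift_prod ?A (concat (map xs js)) (\<Sum>i\<in>UNIV. v $ i *s axis i 1)"
      by (simp add: basis_expansion)
    also have "\<dots> = (\<Sum>i\<in>UNIV. v $ i *s shift_prod ?A (concat (map xs js)) (axis i 1))"
      by (simp add: sum shift_prod_scale)
    finally have "shift_prod ?A (concat (map xs js)) v = 0"
      by (simp add: all)
    then have "(\<Prod>y\<leftarrow>concat (map xs js). x - y) = 0"
      using v by (simp add: shift_prod_eigenvector[OF v(2)] vec.scale_eq_0_iff)
    then show "x \<in> set (concat (map xs js))"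
      by (auto simp: prod_list_zero_iff)
  qed
  then show "finite (eigenvalues A)"
    by (rule finite_subset) simp
  obtain i :: 'n where True
    by simp
  have "axis i 1 \<noteq> (0 :: complex^'n)"
    by (simp add: axis_eq_0_iff)
  then have "xs i \<noteq> []"
    using xs(1)[of i] by auto
  then show "eigenvalues A \<noteq> {}"
    using xs(2)[of i] by (cases "xs i") auto
qed

lemma eigenvalue_le_lambda_max: "x \<in> eigenvalues A \<Longrightarrow> cmod x \<le> lambda_max A"
  unfolding lambda_max_def by (intro Max_ge) (auto simp: finite_eigenvalues)

lemma lambda_max_attained: "\<exists>x\<in>eigenvalues A. lambda_max A = cmod x"
  using Max_in[of "cmod ` eigenvalues A"] eigenvalues_nonempty finite_eigenvalues
  unfolding lambda_max_def by fastforce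

lemma lambda_max_nonneg: "0 \<le> lambda_max A"
  using lambda_max_attained[of A] by auto

lemma norm_vector_scale: "norm (c *s v) = cmod c * norm v" for v :: "complex^'n"
  by (simp add: norm_vec_def norm_mult L2_set_right_distrib)

lemma shifted_matrix_mult: "(B - mat x) *v u = B *v u - x *s u" for B :: "complex^'n^'n"
  by (simp add: vec_eq_iff matrix_vector_mult_def mat_def left_diff_distrib sum_subtractf
      if_distrib[of "\<lambda>c. c * _"] sum.delta cong: if_cong)

lemma orbit_add: "((*v) A ^^ k) (u + v) = ((*v) A ^^ k) u + ((*v) A ^^ k) v"
  for A :: "'a::field^'n^'n"
  by (induction k) (simp_all add: matrix_vector_right_distrib)

lemma orbit_scale: "((*v) A ^^ k) (c *s v) = c *s ((*v) A ^^ k) v" for A :: "'a::field^'n^'n"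
  by (induction k) (simp_all add: vec.scale)

text \<open>The recursion behind all growth estimates: one step multiplies by \<open>x\<close> up to the orbit of
  \<open>(A - x) v\<close>, which has one factor less to be annihilated.\<close>

lemma orbit_Suc_shift:
  "((*v) A ^^ Suc k) v = x *s ((*v) A ^^ k) v + ((*v) A ^^ k) (A *v v - x *s v)"
  for A :: "'a::field^'n^'n"
proof -
  have "A *v v = x *s v + (A *v v - x *s v)"
    by simp
  then have "((*v) A ^^ k) (A *v v) = ((*v) A ^^ k) (x *s v + (A *v v - x *s v))"
    by simp
  then show ?thesis
    by (simp only: orbit_add orbit_scale funpow_Suc_right o_def)
qed

text \<open>The vectors whose orbit is \<open>O(\<rho>\<^sup>k)\<close>; an invariant subspace.\<close>

definition geometric :: "complex^'n^'n \<Rightarrow> real \<Rightarrow> (complex^'n) set" where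
  "geometric A \<rho> = {v. \<exists>C. \<forall>k. norm (((*v) A ^^ k) v) \<le> C * \<rho> ^ k}"

lemma geometricI: "(\<And>k. norm (((*v) A ^^ k) v) \<le> C * \<rho> ^ k) \<Longrightarrow> v \<in> geometric A \<rho>"
  by (auto simp: geometric_def)

lemma geometric_add:
  assumes "u \<in> geometric A \<rho>" "v \<in> geometric A \<rho>"
  shows "u + v \<in> geometric A \<rho>"
proof -
  obtain C D where C: "\<And>k. norm (((*v) A ^^ k) u) \<le> C * \<rho> ^ k"
    and D: "\<And>k. norm (((*v) A ^^ k) v) \<le> D * \<rho> ^ k"
    using assms by (auto simp: geometric_def)
  show ?thesis
    by (rule geometricI[where C = "C + D"])
      (auto simp: orbit_add distrib_right intro!: norm_triangle_le add_mono C D)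
qed

lemma geometric_scale:
  assumes "v \<in> geometric A \<rho>"
  shows "c *s v \<in> geometric A \<rho>"
proof -
  obtain C where C: "\<And>k. norm (((*v) A ^^ k) v) \<le> C * \<rho> ^ k"
    using assms by (auto simp: geometric_def)
  show ?thesis
    by (rule geometricI[where C = "cmod c * C"])
      (auto simp: orbit_scale norm_vector_scale mult.assoc intro!: mult_left_mono C)
qed

lemma geometric_diff:
  assumes "u \<in> geometric A \<rho>" "v \<in> geometric A \<rho>"
  shows "u - v \<in> geometric A \<rho>"
  using geometric_add[OF assms(1) geometric_scale[OF assms(2), of "-1"]]
  by (simp add: vec.scale_minus_left)

lemma geometric_mult:
  assumes "v \<in> geometric A \<rho>"
  shows "A *v v \<in> geometric A \<rho>"
proof -
  obtain C where C: "\<And>k. norm (((*v) A ^^ k) v) \<le> C * \<rho> ^ k"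
    using assms by (auto simp: geometric_def)
  have "norm (((*v) A ^^ k) (A *v v)) \<le> (C * \<rho>) * \<rho> ^ k" for k
    using C[of "Suc k"] by (simp only: funpow_Suc_right o_def power_Suc mult.assoc)
  then show ?thesis
    by (rule geometricI)
qed

lemma geometric_shift_prod:
  assumes "v \<in> geometric A \<rho>"
  shows "shift_prod A xs v \<in> geometric A \<rho>"
  using assms
  by (induction xs arbitrary: v) (simp_all add: geometric_diff geometric_mult geometric_scale)

lemma geometric_eigenvector:
  assumes "A *v v = x *s v" "cmod x \<le> \<rho>"
  shows "v \<in> geometric A \<rho>"
proof -
  have eq: "((*v) A ^^ k) v = x ^ k *s v" for k
    by (induction k) (simp_all add: vec.scale assms(1) mult.commute)
  have "cmod x ^ k \<le> \<rho> ^ k" for k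
    using assms(2) by (intro power_mono) auto
  then have "norm (((*v) A ^^ k) v) \<le> norm v * \<rho> ^ k" for k
    by (simp add: eq norm_vector_scale norm_power mult.commute mult_left_mono)
  then show ?thesis
    by (rule geometricI)
qed

text \<open>With \<open>b k = norm (A\<^sup>k v) / \<rho>\<^sup>k\<close> the recursion reads \<open>b (k + 1) \<le> (cmod x / \<rho>) * b k + const\<close>, a
  contraction, so \<open>b\<close> stays bounded.\<close>

lemma geometric_nondominant_shift:
  assumes "cmod x < \<rho>" "A *v v - x *s v \<in> geometric A \<rho>"
  shows "v \<in> geometric A \<rho>"
proof -
  obtain C where C: "\<And>k. norm (((*v) A ^^ k) (A *v v - x *s v)) \<le> C * \<rho> ^ k"
    using assms by (auto simp: geometric_def)
  \<comment> \<open>\<open>D\<close> starts the induction at \<open>k = 0\<close> and is preserved by the step.\<close>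
  define D where "D = max (norm v) (C / (\<rho> - cmod x))"
  have \<rho>: "0 < \<rho>"
    using assms(1) norm_ge_zero[of x] by linarith
  have "C / (\<rho> - cmod x) \<le> D"
    by (simp add: D_def)
  then have step: "cmod x * D + C \<le> D * \<rho>"
    using assms(1) by (simp add: field_simps)
  have "norm (((*v) A ^^ k) v) \<le> D * \<rho> ^ k" for k
  proof (induction k)
    case 0
    then show ?case
      by (simp add: D_def)
  next
    case (Suc k)
    have "norm (((*v) A ^^ Suc k) v)
        \<le> cmod x * norm (((*v) A ^^ k) v) + norm (((*v) A ^^ k) (A *v v - x *s v))"
      unfolding orbit_Suc_shift[of k A v x]
      by (rule order_trans[OF norm_triangle_ineq]) (simp add: norm_vector_scale)
    also have "\<dots> \<le> cmod x * (D * \<rho> ^ k) + C * \<rho> ^ k"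
      by (intro add_mono mult_left_mono Suc.IH C) auto
    also have "\<dots> = (cmod x * D + C) * \<rho> ^ k"
      by (simp add: algebra_simps)
    also have "\<dots> \<le> (D * \<rho>) * \<rho> ^ k"
      using step \<rho> by (intro mult_right_mono) auto
    finally show ?case
      by (simp add: mult.assoc)
  qed
  then show ?thesis
    by (rule geometricI)
qed

text \<open>A polynomial \<open>p\<close> satisfies \<open>p(A) v - p(x) v = q(A) (A - x) v\<close> for some \<open>q\<close>; here \<open>p\<close> is a product of
  linear factors.\<close>

lemma geometric_shift_prod_remainder:
  assumes "A *v v - x *s v \<in> geometric A \<rho>"
  shows "shift_prod A xs v - (\<Prod>y\<leftarrow>xs. x - y) *s v \<in> geometric A \<rho>"
proof (induction xs)
  case Nil
  show ?case
    by (rule geometricI[where C = 0]) (simp add: orbit_scale[of _ A 0 0, simplified])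
next
  case (Cons y xs)
  let ?u = "A *v v - x *s v"
  have eq: "A *v v - y *s v = ?u + (x - y) *s v"
    by (simp add: vec.scale_left_diff_distrib)
  have "shift_prod A (y # xs) v - (\<Prod>y\<leftarrow>y # xs. x - y) *s v
      = shift_prod A xs ?u + (x - y) *s (shift_prod A xs v - (\<Prod>y\<leftarrow>xs. x - y) *s v)"
    by (simp only: shift_prod.simps eq shift_prod_add shift_prod_scale list.map prod_list.Cons
        vec.scale_right_diff_distrib vec.scale_scale add_diff_eq)
  then show ?case
    using Cons.IH geometric_shift_prod[OF assms] geometric_add geometric_scale by metis
qed

text \<open>Induction on the annihilating list. A nondominant factor \<open>A - x\<close> is removed by the contraction
  argument. A dominant one that occurs again is redundant by semisimplicity. A dominant one that
  does not occur in the rest \<open>p\<close> is split off: \<open>p(A) v\<close> is an eigenvector, it differs from \<open>p(x) v\<close> by a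
  geometric vector, and \<open>p(x) \<noteq> 0\<close>.\<close>

lemma geometric_semisimple:
  assumes semisimple: "\<And>x u. cmod x = \<rho> \<Longrightarrow>
      A *v (A *v u - x *s u) - x *s (A *v u - x *s u) = 0 \<Longrightarrow> A *v u - x *s u = 0"
    and "\<forall>x\<in>set xs. cmod x \<le> \<rho>" "shift_prod A xs v = 0"
  shows "v \<in> geometric A \<rho>"
  using assms(2,3)
proof (induction xs arbitrary: v)
  case Nil
  show ?case
    using Nil by (intro geometricI[where C = 0]) (simp add: orbit_scale[of _ A 0 0, simplified])
next
  case (Cons x xs)
  let ?u = "A *v v - x *s v"
  have u: "?u \<in> geometric A \<rho>"
    using Cons.prems by (intro Cons.IH) auto
  consider "cmod x < \<rho>" | "cmod x = \<rho>" "x \<in> set xs" | "cmod x = \<rho>" "x \<notin> set xs"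
    using Cons.prems by force
  then show ?case
  proof cases
    case 1
    then show ?thesis
      using u by (rule geometric_nondominant_shift)
  next
    case 2
    then obtain ys zs where xs: "xs = ys @ x # zs"
      using split_list by metis
    let ?w = "shift_prod A (ys @ zs) v"
    have "shift_prod A xs v = A *v ?w - x *s ?w"
      by (simp add: xs shift_prod_middle Let_def)
    moreover have "shift_prod A (x # xs) v = A *v (A *v ?w - x *s ?w) - x *s (A *v ?w - x *s ?w)"
      using shift_prod_middle[of A "[]" x xs v] calculation by (simp add: Let_def)
    ultimately have "shift_prod A xs v = 0"
      using semisimple[OF 2(1), of ?w] Cons.prems by simp
    then show ?thesis
      using Cons by auto
  next
    case 3
    let ?z = "shift_prod A xs v" and ?c = "\<Prod>y\<leftarrow>xs. x - y"
    have "A *v ?z - x *s ?z = shift_prod A (x # xs) v"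
      using shift_prod_middle[of A "[]" x xs v] by (simp add: Let_def)
    then have "?z \<in> geometric A \<rho>"
      using Cons.prems 3 by (intro geometric_eigenvector[of A _ x]) auto
    from geometric_diff[OF this geometric_shift_prod_remainder[OF u, of xs]]
    have "?c *s v \<in> geometric A \<rho>"
      by simp
    moreover have "?c \<noteq> 0"
      using 3 by (auto simp: prod_list_zero_iff)
    ultimately show ?thesis
      using geometric_scale[of "?c *s v" A \<rho> "inverse ?c"] by (simp add: vec.scale_scale)
  qed
qed

text \<open>Each factor \<open>A - x\<close> beyond the first adds a power of \<open>k\<close>: summing the recursion
  \<open>b (k + 1) \<le> b k + const * (k + 1)\<^sup>q\<close> raises the degree by one.\<close>

lemma polynomial_growth:
  assumes "0 < \<rho>" "\<forall>x\<in>set xs. cmod x \<le> \<rho>" "shift_prod A xs v = 0"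
  shows "\<exists>C\<ge>0. \<forall>k. norm (((*v) A ^^ k) v) \<le> C * (real k + 1) ^ (length xs - 1) * \<rho> ^ k"
  using assms(2,3)
proof (induction xs arbitrary: v)
  case Nil
  then show ?case
    by (intro exI[of _ 0]) (simp add: orbit_scale[of _ A 0 0, simplified])
next
  case (Cons x xs)
  show ?case
  proof (cases "xs = []")
    case True
    then have "v \<in> geometric A \<rho>"
      using Cons.prems by (intro geometric_eigenvector[of A v x]) auto
    then obtain C where C: "\<And>k. norm (((*v) A ^^ k) v) \<le> C * \<rho> ^ k"
      by (auto simp: geometric_def)
    then show ?thesis
      using True C[of 0] order_trans[OF norm_ge_zero C[of 0]] by (intro exI[of _ C]) auto
  next
    case False
    let ?u = "A *v v - x *s v"
    define q where "q = length xs - 1"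
    obtain C where C: "C \<ge> 0" "\<And>k. norm (((*v) A ^^ k) ?u) \<le> C * (real k + 1) ^ q * \<rho> ^ k"
      using Cons.IH[of ?u] Cons.prems by (auto simp: q_def)
    define D where "D = max (norm v) (C / \<rho>)"
    have D: "0 \<le> D" "C \<le> D * \<rho>"
      using assms(1) by (auto simp: D_def le_max_iff_disj pos_divide_le_eq[symmetric])
    have "norm (((*v) A ^^ k) v) \<le> D * (real k + 1) ^ Suc q * \<rho> ^ k" for k
    proof (induction k)
      case 0
      then show ?case
        by (simp add: D_def)
    next
      case (Suc k)
      have "norm (((*v) A ^^ Suc k) v) \<le> cmod x * norm (((*v) A ^^ k) v) + norm (((*v) A ^^ k) ?u)"
        unfolding orbit_Suc_shift[of k A v x]
        by (rule order_trans[OF norm_triangle_ineq]) (simp add: norm_vector_scale)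
      also have "\<dots> \<le> \<rho> * (D * (real k + 1) ^ Suc q * \<rho> ^ k) + (D * \<rho>) * (real k + 1) ^ q * \<rho> ^ k"
        using assms(1) Cons.prems D
        by (intro add_mono mult_mono Suc.IH order_trans[OF C(2)] mult_right_mono) auto
      also have "\<dots> = D * \<rho> ^ Suc k * ((real k + 2) * (real k + 1) ^ q)"
        by (simp add: algebra_simps)
      also have "\<dots> \<le> D * \<rho> ^ Suc k * ((real k + 2) * (real k + 2) ^ q)"
        using assms(1) D by (intro mult_left_mono power_mono) auto
      finally show ?case
        by (simp add: algebra_simps)
    qed
    then show ?thesis
      using False D by (intro exI[of _ D]) (auto simp: q_def)
  qed
qed

definition complex_vector :: "real^'n \<Rightarrow> complex^'n" where
  "complex_vector v = (\<chi> i. complex_of_real (v $ i))"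

lemma norm_complex_vector: "norm (complex_vector v) = norm v"
  by (simp add: norm_vec_def complex_vector_def)

lemma complex_matrix_mult_vector:
  "complex_matrix A *v complex_vector v = complex_vector (A *v v)"
  by (simp add: vec_eq_iff matrix_vector_mult_def complex_matrix_def complex_vector_def)

lemma matrix_power_mult_vector: "matrix_power A k *v v = ((*v) A ^^ k) v"
  by (induction k) (simp_all add: matrix_power_def flip: matrix_vector_mul_assoc)

lemma complex_orbit:
  "((*v) (complex_matrix A) ^^ k) (complex_vector v) = complex_vector (matrix_power A k *v v)"
  by (induction k) (simp_all add: matrix_power_mult_vector complex_matrix_mult_vector)

lemma matrix_power_bound_from_orbits:
  fixes A :: "real^'n^'n"
  assumes "\<And>k. N \<le> k \<Longrightarrow> 0 \<le> r k"
    and "\<And>v. \<exists>C. \<forall>k\<ge>N. norm (((*v) (complex_matrix A) ^^ k) v) \<le> C * r k"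
  shows "\<exists>C\<ge>0. \<forall>k\<ge>N. \<forall>w. norm (matrix_power A k *v w) \<le> C * r k * norm w"
proof -
  have "\<exists>C. \<forall>k\<ge>N. norm (matrix_power A k *v axis i 1) \<le> C * r k" for i
    using assms(2)[of "complex_vector (axis i 1)"] by (simp add: complex_orbit norm_complex_vector)
  then obtain C where C: "\<And>i k. N \<le> k \<Longrightarrow> norm (matrix_power A k *v axis i 1) \<le> C i * r k"
    by metis
  define D where "D = (\<Sum>i\<in>UNIV. \<bar>C i\<bar>)"
  have "norm (matrix_power A k *v w) \<le> D * r k * norm w" if k: "N \<le> k" for k w
  proof -
    have "matrix_power A k *v w = (\<Sum>i\<in>UNIV. w $ i *\<^sub>R (matrix_power A k *v axis i 1))"
      by (subst matrix_mult_sum) (simp add: matrix_vector_mult_basis scalar_mult_eq_scaleR)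
    also have "norm \<dots> \<le> (\<Sum>i\<in>UNIV. norm w * (\<bar>C i\<bar> * r k))"
    proof (rule order_trans[OF norm_sum], rule sum_mono)
      fix i
      have "norm (matrix_power A k *v axis i 1) \<le> \<bar>C i\<bar> * r k"
        using C[OF k, of i] assms(1)[OF k] by (meson abs_ge_self mult_right_mono order_trans)
      then show "norm (w $ i *\<^sub>R (matrix_power A k *v axis i 1)) \<le> norm w * (\<bar>C i\<bar> * r k)"
        using component_le_norm_cart[of w i] by (simp add: mult_mono)
    qed
    also have "\<dots> = D * r k * norm w"
      by (simp add: D_def sum_distrib_left sum_distrib_right mult_ac)
    finally show ?thesis .
  qed
  then show ?thesis
    by (intro exI[of _ D]) (auto simp: D_def intro: sum_nonneg)
qed

text \<open>The bound starts at the dimension \<open>m\<close> because of \<open>lambda_max A = 0\<close>: then \<open>A\<close> is nilpotent, its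
  powers vanish from the \<open>m\<close>-th on, but earlier ones need not.\<close>

lemma matrix_power_bound:
  fixes A :: "real^'n^'n"
  defines "m \<equiv> CARD('n)"
  shows "\<exists>C\<ge>0. \<forall>k\<ge>m. \<forall>w.
    norm (matrix_power A k *v w) \<le> C * (real k ^ (m - 1) * lambda_max A ^ k) * norm w"
proof (rule matrix_power_bound_from_orbits)
  show "0 \<le> real k ^ (m - 1) * lambda_max A ^ k" for k
    by (simp add: lambda_max_nonneg)
next
  fix v
  let ?A = "complex_matrix A" and ?\<rho> = "lambda_max A"
  obtain xs where xs: "set xs \<subseteq> eigenvalues A" "length xs \<le> m" "shift_prod ?A xs v = 0"
    using exists_annihilating_eigenvalues unfolding m_def by blast
  have le: "\<forall>x\<in>set xs. cmod x \<le> ?\<rho>"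
    using xs(1) eigenvalue_le_lambda_max by blast
  show "\<exists>C. \<forall>k\<ge>m. norm (((*v) ?A ^^ k) v) \<le> C * (real k ^ (m - 1) * ?\<rho> ^ k)"
  proof (cases "?\<rho> = 0")
    case True
    then have "((*v) ?A ^^ length xs) v = 0"
      using xs(3) le shift_prod_zeros[of xs ?A v] by force
    then have "((*v) ?A ^^ k) v = 0" if "m \<le> k" for k
      using that xs(2) funpow_add[of "k - length xs" "length xs" "(*v) ?A"]
        orbit_scale[of "k - length xs" ?A 0 0]
      by simp
    then show ?thesis
      by (intro exI[of _ 0]) auto
  next
    case False
    then have pos: "0 < ?\<rho>"
      using lambda_max_nonneg[of A] by simp
    obtain C where C: "C \<ge> 0" "\<And>k. norm (((*v) ?A ^^ k) v) \<le> C * (real k + 1) ^ (length xs - 1) * ?\<rho> ^ k"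
      using polynomial_growth[OF pos le xs(3)] by blast
    have "norm (((*v) ?A ^^ k) v) \<le> C * 2 ^ (m - 1) * (real k ^ (m - 1) * ?\<rho> ^ k)" if "m \<le> k" for k
    proof -
      have "1 \<le> real k"
        using that zero_less_card_finite[where 'a = 'n] unfolding m_def by linarith
      have "norm (((*v) ?A ^^ k) v) \<le> C * (real k + 1) ^ (length xs - 1) * ?\<rho> ^ k"
        by (rule C)
      also have "\<dots> \<le> C * (2 * real k) ^ (m - 1) * ?\<rho> ^ k"
      proof (intro mult_right_mono mult_left_mono)
        have "(real k + 1) ^ (length xs - 1) \<le> (real k + 1) ^ (m - 1)"
          using xs(2) by (intro power_increasing) auto
        also have "\<dots> \<le> (2 * real k) ^ (m - 1)"
          using \<open>1 \<le> real k\<close> by (intro power_mono) auto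
        finally show "(real k + 1) ^ (length xs - 1) \<le> (2 * real k) ^ (m - 1)" .
      qed (use C pos in auto)
      finally show ?thesis
        by (simp add: power_mult_distrib mult_ac)
    qed
    then show ?thesis
      by blast
  qed
qed

lemma matrix_power_bound_semisimple:
  fixes A :: "real^'n^'n"
  assumes "dominant_semisimple A"
  shows "\<exists>C\<ge>0. \<forall>k. \<forall>w. norm (matrix_power A k *v w) \<le> C * lambda_max A ^ k * norm w"
proof -
  let ?A = "complex_matrix A" and ?\<rho> = "lambda_max A"
  have "v \<in> geometric ?A ?\<rho>" for v
  proof -
    obtain xs where xs: "set xs \<subseteq> eigenvalues A" "shift_prod ?A xs v = 0"
      using exists_annihilating_eigenvalues by blast
    show ?thesis
    proof (rule geometric_semisimple[OF _ _ xs(2)])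
      show "\<forall>x\<in>set xs. cmod x \<le> ?\<rho>"
        using xs(1) eigenvalue_le_lambda_max by blast
    qed (use assms in \<open>auto simp: dominant_semisimple_def shifted_matrix_mult\<close>)
  qed
  then show ?thesis
    using matrix_power_bound_from_orbits[of 0 "\<lambda>k. ?\<rho> ^ k" A] lambda_max_nonneg[of A]
    by (auto simp: geometric_def)
qed

section \<open>Stability of the steady-state filter\<close>

lemma inner_matrix_vector: "x \<bullet> (M *v y) = (transpose M *v x) \<bullet> y" for M :: "real^'n^'m"
  by (simp add: dot_lmul_matrix)

text \<open>The stability proof uses left eigenvectors, since the Riccati equation has the form
  \<open>P = A P A\<^sup>T + \<dots>\<close>.\<close>

lemma eigenvalues_transpose: "eigenvalues (transpose A) = eigenvalues A" for A :: "real^'n^'n"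
proof -
  have "x \<in> eigenvalues B \<longleftrightarrow> \<not> invertible (complex_matrix B - mat x)" for x and B :: "real^'n^'n"
    unfolding eigenvalues_def invertible_left_inverse matrix_left_invertible_ker
    by (auto simp: shifted_matrix_mult)
  moreover have "complex_matrix (transpose A) - mat x = transpose (complex_matrix A - mat x)" for x
    by (simp add: vec_eq_iff complex_matrix_def transpose_def mat_def)
  moreover have "invertible (transpose B) \<longleftrightarrow> invertible B" for B :: "complex^'n^'n"
    by (simp add: invertible_det_nz)
  ultimately show ?thesis
    by auto
qed

text \<open>The complex eigenvalue equation in real coordinates, so that the quadratic form of \<open>P\<close> can be used
  without extending it to complex vectors.\<close>

lemma eigenvalues_iff_real_imag:
  "x \<in> eigenvalues A \<longleftrightarrow> (\<exists>u v. (u \<noteq> 0 \<or> v \<noteq> 0) \<and>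
     A *v u = Re x *\<^sub>R u - Im x *\<^sub>R v \<and> A *v v = Im x *\<^sub>R u + Re x *\<^sub>R v)"
proof -
  have "complex_matrix A *v w = x *s w \<longleftrightarrow>
      (let u = (\<chi> i. Re (w $ i)); v = (\<chi> i. Im (w $ i)) in
        A *v u = Re x *\<^sub>R u - Im x *\<^sub>R v \<and> A *v v = Im x *\<^sub>R u + Re x *\<^sub>R v)" for w
    by (auto simp: vec_eq_iff matrix_vector_mult_def complex_matrix_def complex_eq_iff Let_def
        algebra_simps)
  moreover have "w \<noteq> 0 \<longleftrightarrow> (\<chi> i. Re (w $ i)) \<noteq> 0 \<or> (\<chi> i. Im (w $ i)) \<noteq> 0" for w :: "complex^'n"
    by (auto simp: vec_eq_iff complex_eq_iff)
  moreover have "\<exists>w. u = (\<chi> i. Re (w $ i)) \<and> v = (\<chi> i. Im (w $ i))" for u v :: "real^'n"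
    by (intro exI[of _ "\<chi> i. Complex (u $ i) (v $ i)"]) (simp add: vec_eq_iff)
  ultimately show ?thesis
    unfolding eigenvalues_def mem_Collect_eq Let_def by metis
qed

lemma transpose_diff: "transpose (A - B) = transpose A - transpose B" for A B :: "real^'n^'m"
  by (simp add: vec_eq_iff transpose_def)

lemma transpose_closed_loop:
  "transpose (closed_loop S P)
    = transpose (trans_mat S) - transpose (obs_mat S) ** transpose (kalman_gain S P)"
  by (simp add: closed_loop_def transpose_diff matrix_transpose_mul)

text \<open>The Riccati equation in Joseph form, \<open>P = A P A\<^sup>T + K H K\<^sup>T + G Q G\<^sup>T\<close> with the closed loop matrix \<open>A\<close>,
  written as an identity of quadratic forms. It rests on \<open>K W = T P Z\<^sup>T\<close>, where
  \<open>W = Z P Z\<^sup>T + H\<close> is invertible because it is positive definite.\<close>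

lemma joseph_form:
  fixes S :: "('m::finite, 'p::finite, 'r::finite) state_space"
  assumes H: "pos_def (obs_cov S)" and P: "riccati_solution S P"
  defines "K \<equiv> kalman_gain S P"
  shows "x \<bullet> (P *v x) =
      (transpose (closed_loop S P) *v x) \<bullet> (P *v (transpose (closed_loop S P) *v x))
      + (transpose K *v x) \<bullet> (obs_cov S *v (transpose K *v x))
      + (transpose (noise_mat S) *v x) \<bullet> (state_cov S *v (transpose (noise_mat S) *v x))"
proof -
  define Z T G H Q where defs: "Z = obs_mat S" "T = trans_mat S" "G = noise_mat S"
    "H = obs_cov S" "Q = state_cov S"
  define W where "W = Z ** P ** transpose Z + H"
  have K: "K = T ** P ** transpose Z ** matrix_inv W"
    by (simp add: K_def kalman_gain_def defs W_def)
  have psd: "0 \<le> y \<bullet> (P *v y)" for y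
    using P by (simp add: riccati_solution_def pos_semidef_def)
  have "y = 0" if "W *v y = 0" for y
  proof (rule ccontr)
    assume "y \<noteq> 0"
    then have "0 < y \<bullet> (H *v y)"
      using H by (simp add: pos_def_def defs)
    moreover have "y \<bullet> (W *v y) = (transpose Z *v y) \<bullet> (P *v (transpose Z *v y)) + y \<bullet> (H *v y)"
      by (simp only: W_def matrix_vector_mult_add_rdistrib inner_add_right inner_matrix_vector[of y Z]
          flip: matrix_vector_mul_assoc)
    ultimately show False
      using psd[of "transpose Z *v y"] that by simp
  qed
  then have "invertible W"
    by (simp add: invertible_left_inverse matrix_left_invertible_ker)
  then have "matrix_inv W ** W = mat 1"
    unfolding matrix_inv_def invertible_def by (metis (mono_tags, lifting) someI_ex)
  then have KW: "K ** W = T ** P ** transpose Z"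
    by (simp add: K flip: matrix_mul_assoc)
  define a b g where "a = transpose T *v x" "b = transpose K *v x" "g = transpose G *v x"
  define z where "z = transpose Z *v b"
  have "x \<bullet> ((K ** W) *v b) = b \<bullet> (W *v b)"
    by (simp only: a_b_g_def inner_matrix_vector[of x K] flip: matrix_vector_mul_assoc)
  also have "\<dots> = z \<bullet> (P *v z) + b \<bullet> (H *v b)"
    by (simp only: W_def matrix_vector_mult_add_rdistrib inner_add_right inner_matrix_vector[of b Z]
        z_def flip: matrix_vector_mul_assoc)
  finally have 1: "a \<bullet> (P *v z) = z \<bullet> (P *v z) + b \<bullet> (H *v b)"
    by (simp only: KW inner_matrix_vector[of x T] a_b_g_def z_def flip: matrix_vector_mul_assoc)
  have "P = T ** P ** transpose T - K ** Z ** P ** transpose T + G ** Q ** transpose G"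
    using P by (simp add: riccati_solution_def Let_def K W_def defs)
  then have "x \<bullet> (P *v x) = x \<bullet> ((T ** P ** transpose T - K ** Z ** P ** transpose T
      + G ** Q ** transpose G) *v x)"
    by simp
  also have "\<dots> = a \<bullet> (P *v a) - z \<bullet> (P *v a) + g \<bullet> (Q *v g)"
    by (simp only: matrix_vector_mult_add_rdistrib matrix_vector_mult_diff_rdistrib inner_add_right
        inner_diff_right inner_matrix_vector[of x T] inner_matrix_vector[of x K]
        inner_matrix_vector[of x G] inner_matrix_vector[of _ Z] a_b_g_def z_def
        flip: matrix_vector_mul_assoc)
  finally have 2: "x \<bullet> (P *v x) = a \<bullet> (P *v a) - z \<bullet> (P *v a) + g \<bullet> (Q *v g)" .
  have "transpose (closed_loop S P) = transpose T - transpose Z ** transpose K"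
    by (simp add: transpose_closed_loop K_def defs)
  then have "transpose (closed_loop S P) *v x = a - z"
    by (simp only: matrix_vector_mult_diff_rdistrib a_b_g_def z_def matrix_vector_mul_assoc)
  then show ?thesis
    using 1 2 by (simp add: matrix_vector_mult_diff_distrib inner_diff_left inner_diff_right
        a_b_g_def defs)
qed

text \<open>Let \<open>v\<close> be a left eigenvector of \<open>A\<close> with eigenvalue of modulus at least \<open>1\<close>. In the Joseph form at \<open>v\<close>
  the term from \<open>A P A\<^sup>T\<close> is already as large as the left hand side, so the nonnegative term of \<open>H\<close>
  vanishes and \<open>K\<^sup>T v = 0\<close>. Then \<open>A\<^sup>T v = T\<^sup>T v\<close>, and \<open>T\<close> has the same eigenvalue, contrary to its
  stability.\<close>

lemma closed_loop_stable:
  fixes S :: "('m::finite, 'p::finite, 'r::finite) state_space"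
  assumes H: "pos_def (obs_cov S)" and Q: "pos_def (state_cov S)"
    and P: "riccati_solution S P" and T: "lambda_max (trans_mat S) < 1"
  shows "lambda_max (closed_loop S P) < 1"
proof (rule ccontr)
  let ?A = "transpose (closed_loop S P)" and ?K = "transpose (kalman_gain S P)"
    and ?G = "transpose (noise_mat S)"
  assume unstable: "\<not> lambda_max (closed_loop S P) < 1"
  obtain ev where ev: "ev \<in> eigenvalues ?A" "1 \<le> cmod ev"
    using lambda_max_attained[of "closed_loop S P"] unstable by (auto simp: eigenvalues_transpose)
  define r s where rs: "r = Re ev" "s = Im ev"
  obtain u v where uv: "u \<noteq> 0 \<or> v \<noteq> 0" "?A *v u = r *\<^sub>R u - s *\<^sub>R v" "?A *v v = s *\<^sub>R u + r *\<^sub>R v"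
    using ev(1) unfolding eigenvalues_iff_real_imag rs by blast
  have psd: "0 \<le> x \<bullet> (P *v x)" for x
    using P by (simp add: riccati_solution_def pos_semidef_def)
  have posH: "0 < x \<bullet> (obs_cov S *v x)" if "x \<noteq> 0" for x
    using H that by (simp add: pos_def_def)
  have nonnegH: "0 \<le> x \<bullet> (obs_cov S *v x)" for x
    using posH[of x] by (cases "x = 0") auto
  have nonnegQ: "0 \<le> x \<bullet> (state_cov S *v x)" for x
    using Q by (cases "x = 0") (auto simp: pos_def_def intro: less_imp_le)
  define q where "q = u \<bullet> (P *v u) + v \<bullet> (P *v v)"
  define h where "h = (?K *v u) \<bullet> (obs_cov S *v (?K *v u)) + (?K *v v) \<bullet> (obs_cov S *v (?K *v v))"
  have "(?A *v u) \<bullet> (P *v (?A *v u)) + (?A *v v) \<bullet> (P *v (?A *v v)) = (r\<^sup>2 + s\<^sup>2) * q"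
    unfolding uv by (simp add: q_def matrix_vector_mult_diff_distrib matrix_vector_right_distrib
        matrix_vector_mult_scaleR inner_simps algebra_simps power2_eq_square)
  then have "q = (r\<^sup>2 + s\<^sup>2) * q + h
      + ((?G *v u) \<bullet> (state_cov S *v (?G *v u)) + (?G *v v) \<bullet> (state_cov S *v (?G *v v)))"
    using joseph_form[OF H P, of u] joseph_form[OF H P, of v] by (simp add: q_def h_def)
  moreover have "1 \<le> r\<^sup>2 + s\<^sup>2"
    using ev(2) by (simp add: cmod_def rs)
  \<comment> \<open>An eigenvalue outside the open unit disc leaves no room for the term \<open>h\<close>.\<close>
  then have "q \<le> (r\<^sup>2 + s\<^sup>2) * q"
    using psd[of u] psd[of v] mult_right_mono[of 1 "r\<^sup>2 + s\<^sup>2" q] by (simp add: q_def)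
  ultimately have "h \<le> 0"
    using nonnegQ[of "?G *v u"] nonnegQ[of "?G *v v"] by linarith
  then have K0: "?K *v u = 0" "?K *v v = 0"
    using nonnegH[of "?K *v u"] nonnegH[of "?K *v v"] posH[of "?K *v u"] posH[of "?K *v v"]
    unfolding h_def by linarith+
  have "?A *v x = transpose (trans_mat S) *v x" if "?K *v x = 0" for x
    unfolding transpose_closed_loop matrix_vector_mult_diff_rdistrib
    using that by (simp only: matrix_vector_mul_assoc[symmetric] matrix_vector_mult_0_right) simp
  then have "transpose (trans_mat S) *v u = r *\<^sub>R u - s *\<^sub>R v"
    "transpose (trans_mat S) *v v = s *\<^sub>R u + r *\<^sub>R v"
    using uv(2,3) K0 by simp_all
  then have "ev \<in> eigenvalues (transpose (trans_mat S))"
    unfolding eigenvalues_iff_real_imag rs[symmetric] using uv(1) by blast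
  then have "ev \<in> eigenvalues (trans_mat S)"
    by (simp add: eigenvalues_transpose)
  then show False
    using eigenvalue_le_lambda_max ev(2) T by fastforce
qed

section \<open>Induced norms of the Kalman coefficients\<close>

lemma is_norm_sum:
  assumes "is_norm l" "finite I"
  shows "l (\<Sum>i\<in>I. f i) \<le> (\<Sum>i\<in>I. l (f i))"
  using assms(2)
proof (induction I rule: finite_induct)
  case empty
  have "l 0 = 0"
    using assms(1) unfolding is_norm_def by blast
  then show ?case
    by simp
next
  case (insert i I)
  have "l (f i + sum f I) \<le> l (f i) + l (sum f I)"
    using assms(1) by (simp add: is_norm_def)
  then show ?case
    using insert by simp
qed

lemma is_norm_reverse_triangle:
  assumes "is_norm l"
  shows "\<bar>l x - l y\<bar> \<le> l (x - y)"
proof -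
  have tri: "l (u + v) \<le> l u + l v" and scale: "l (c *\<^sub>R u) = \<bar>c\<bar> * l u" for u v c
    using assms by (auto simp: is_norm_def)
  have neg: "l (- u) = l u" for u
    using scale[of "-1" u] by simp
  show "\<bar>l x - l y\<bar> \<le> l (x - y)"
    using tri[of "x - y" y] tri[of "y - x" x] neg[of "x - y"] by simp
qed

lemma is_norm_le_norm:
  fixes l :: "real^'n \<Rightarrow> real"
  assumes "is_norm l"
  shows "\<exists>c>0. \<forall>x. l x \<le> c * norm x"
proof -
  have nonneg: "0 \<le> l x" and scale: "l (c *\<^sub>R x) = \<bar>c\<bar> * l x" for c x
    using assms by (auto simp: is_norm_def)
  define c where "c = (\<Sum>i\<in>UNIV. l (axis i 1 :: real^'n))"
  have "l x \<le> (c + 1) * norm x" for x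
  proof -
    have "l x = l (\<Sum>i\<in>UNIV. x $ i *\<^sub>R axis i 1)"
      using basis_expansion[of x] by (simp add: scalar_mult_eq_scaleR)
    also have "\<dots> \<le> (\<Sum>i\<in>UNIV. l (x $ i *\<^sub>R axis i 1))"
      by (rule is_norm_sum[OF assms]) simp
    also have "\<dots> \<le> (\<Sum>i\<in>UNIV. norm x * l (axis i 1))"
      using nonneg by (intro sum_mono) (auto simp: scale component_le_norm_cart intro: mult_right_mono)
    also have "\<dots> = c * norm x"
      by (simp add: c_def sum_distrib_left mult.commute)
    also have "\<dots> \<le> (c + 1) * norm x"
      by (intro mult_right_mono) auto
    finally show ?thesis .
  qed
  moreover have "0 < c + 1"
    unfolding c_def using nonneg by (intro add_nonneg_pos sum_nonneg) auto
  ultimately show ?thesis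
    by blast
qed

lemma is_norm_continuous:
  fixes l :: "real^'n \<Rightarrow> real"
  assumes "is_norm l"
  shows "continuous_on UNIV l"
proof -
  obtain c where c: "c > 0" "\<And>x. l x \<le> c * norm x"
    using is_norm_le_norm[OF assms] by blast
  have "c-lipschitz_on UNIV l"
    using c is_norm_reverse_triangle[OF assms]
    by (intro lipschitz_onI) (auto simp: dist_norm intro: order_trans)
  then show ?thesis
    by (rule lipschitz_on_continuous_on)
qed

lemma is_norm_measurable: "is_norm l \<Longrightarrow> l \<in> borel_measurable borel" for l :: "real^'n \<Rightarrow> real"
  by (rule borel_measurable_continuous_onI[OF is_norm_continuous])

text \<open>Equivalence of norms in finite dimension: \<open>l\<close> has a positive minimum on the unit sphere.\<close>

lemma norm_le_is_norm:
  fixes l :: "real^'n \<Rightarrow> real"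
  assumes "is_norm l"
  shows "\<exists>c>0. \<forall>x. norm x \<le> c * l x"
proof -
  have "continuous_on (sphere 0 1) l"
    using is_norm_continuous[OF assms] continuous_on_subset by blast
  moreover have "sphere (0 :: real^'n) 1 \<noteq> {}"
    by simp
  ultimately obtain y where y: "y \<in> sphere 0 1" "\<And>x. x \<in> sphere 0 1 \<Longrightarrow> l y \<le> l x"
    using continuous_attains_inf[of "sphere 0 1" l] by auto
  have "y \<noteq> 0"
    using y(1) by auto
  then have pos: "0 < l y"
    using assms by (simp add: is_norm_def less_le)
  have "norm x \<le> (1 / l y) * l x" for x
  proof (cases "x = 0")
    case True
    then show ?thesis
      using assms by (simp add: is_norm_def)
  next
    case False
    then have "l y \<le> l ((1 / norm x) *\<^sub>R x)"
      by (intro y(2)) simp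
    also have "\<dots> = (1 / norm x) * l x"
      using assms by (simp add: is_norm_def)
    finally show ?thesis
      using False pos by (simp add: field_simps)
  qed
  then show ?thesis
    using pos by (intro exI[of _ "1 / l y"]) auto
qed

lemma matrix_vector_norm_bound: "\<exists>B\<ge>0. \<forall>w. norm (A *v w) \<le> B * norm w" for A :: "real^'n^'m"
proof -
  obtain B where "0 \<le> B" "\<And>w. norm (A *v w) \<le> norm w * B"
    using bounded_linear.nonneg_bounded[OF matrix_vector_mul_bounded_linear[of A]] by blast
  then show ?thesis
    by (intro exI[of _ B]) (simp add: mult.commute)
qed

text \<open>The supremum in \<open>induced_norm\<close> is finite by the equivalence of \<open>l\<close> with the Euclidean norm, which
  also compares the induced norm with Euclidean operator bounds.\<close>

lemma induced_norm_bounds: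
  fixes l :: "real^'p \<Rightarrow> real"
  assumes "is_norm l"
  shows "l (A *v z) \<le> induced_norm l A * l z" and "0 \<le> induced_norm l A"
    and "\<exists>c\<ge>0. \<forall>A B. 0 \<le> B \<longrightarrow> (\<forall>w. norm (A *v w) \<le> B * norm w) \<longrightarrow> induced_norm l A \<le> c * B"
proof -
  have nonneg: "0 \<le> l x" and zero: "l x = 0 \<longleftrightarrow> x = 0" for x
    using assms by (auto simp: is_norm_def)
  then have pos: "0 < l x" if "x \<noteq> 0" for x
    using that nonneg[of x] zero[of x] by (simp add: less_le)
  have "axis i 1 \<in> UNIV - {0 :: real^'p}" for i
    by (simp add: axis_eq_0_iff)
  then have ne: "UNIV - {0 :: real^'p} \<noteq> {}"
    by blast
  obtain c1 where c1: "c1 > 0" "\<And>x. l x \<le> c1 * norm x"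
    using is_norm_le_norm[OF assms] by blast
  obtain c2 where c2: "c2 > 0" "\<And>x. norm x \<le> c2 * l x"
    using norm_le_is_norm[OF assms] by blast
  have ratio: "l (A *v z) / l z \<le> c1 * c2 * B"
    if "0 \<le> B" "\<And>w. norm (A *v w) \<le> B * norm w" "z \<noteq> 0" for A B z
  proof -
    have "l (A *v z) \<le> c1 * (B * norm z)"
      using c1(2)[of "A *v z"] mult_left_mono[OF that(2)[of z], of c1] c1(1) by linarith
    also have "\<dots> \<le> c1 * (B * (c2 * l z))"
      using c1 c2 that(1) by (intro mult_left_mono) auto
    finally show ?thesis
      using pos[OF that(3)] by (simp add: field_simps)
  qed
  have bdd: "bdd_above ((\<lambda>z. l (A *v z) / l z) ` (UNIV - {0}))" for A :: "real^'p^'p"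
  proof -
    obtain B where "0 \<le> B" "\<And>w. norm (A *v w) \<le> B * norm w"
      using matrix_vector_norm_bound[of A] by blast
    then show ?thesis
      using ratio by (intro bdd_aboveI2[where M = "c1 * c2 * B"]) auto
  qed
  have upper: "l (A *v z) / l z \<le> induced_norm l A" if "z \<noteq> 0" for z
    unfolding induced_norm_def using that by (intro cSUP_upper bdd) auto
  show "l (A *v z) \<le> induced_norm l A * l z"
  proof (cases "z = 0")
    case True
    then show ?thesis
      using zero[of 0] by simp
  next
    case False
    then show ?thesis
      using upper[of z] pos[of z] by (simp add: field_simps)
  qed
  obtain z :: "real^'p" where "z \<noteq> 0"
    using ne by blast
  then show "0 \<le> induced_norm l A"
    using upper[of z] divide_nonneg_nonneg[OF nonneg nonneg, of "A *v z" z] by linarith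
  show "\<exists>c\<ge>0. \<forall>A B. 0 \<le> B \<longrightarrow> (\<forall>w. norm (A *v w) \<le> B * norm w) \<longrightarrow> induced_norm l A \<le> c * B"
  proof (intro exI[of _ "c1 * c2"] conjI allI impI)
    fix A :: "real^'p^'p" and B :: real
    assume "0 \<le> B" "\<forall>w. norm (A *v w) \<le> B * norm w"
    then show "induced_norm l A \<le> c1 * c2 * B"
      unfolding induced_norm_def using ratio by (intro cSUP_least ne) blast
  qed (use c1 c2 in simp)
qed

text \<open>Differentiating a power series preserves its radius of convergence and multiplies the \<open>j\<close>-th
  coefficient by about \<open>j\<close>.\<close>

lemma summable_polynomial_geometric:
  fixes x :: real
  assumes "0 \<le> x" "x < 1"
  shows "summable (\<lambda>j. (1 + real j) ^ q * x ^ j)"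
  using assms
proof (induction q arbitrary: x)
  case 0
  then show ?case
    by (simp add: summable_geometric)
next
  case (Suc q)
  have norm_eq: "norm ((1 + real j) ^ q * y ^ j) = (1 + real j) ^ q * norm y ^ j" for j and y :: real
    by (simp add: abs_mult power_abs)
  have "summable (\<lambda>j. (1 + real j) ^ q * y ^ j)" if "norm y < 1" for y :: real
    using Suc.IH[OF norm_ge_zero that] unfolding norm_eq[symmetric] by (rule summable_norm_cancel)
  moreover have "norm x < 1"
    using Suc.prems by simp
  ultimately have "summable (\<lambda>j. diffs (\<lambda>j. (1 + real j) ^ q) j * x ^ j)"
    by (intro termdiff_converges[where K = 1])
  moreover have "norm ((1 + real j) ^ Suc q * x ^ j) \<le> diffs (\<lambda>j. (1 + real j) ^ q) j * x ^ j" for j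
  proof -
    have "(1 + real j) * (1 + real j) ^ q \<le> (1 + real j) * (2 + real j) ^ q"
      by (intro mult_left_mono power_mono) auto
    then have "(1 + real j) ^ Suc q * x ^ j \<le> (1 + real j) * (2 + real j) ^ q * x ^ j"
      using Suc.prems(1) by (intro mult_right_mono) simp_all
    then show ?thesis
      using Suc.prems(1) by (simp add: diffs_def add.commute)
  qed
  ultimately show ?case
    by (rule summable_comparison_test'[where N = 0])
qed

text \<open>With \<open>k = d + j\<close> and \<open>d \<ge> 1\<close> one has \<open>k \<le> d * (1 + j)\<close>, so that the first term dominates the tail up to
  a constant factor independent of \<open>d\<close>.\<close>

lemma polynomial_geometric_tail:
  fixes \<rho> :: real
  assumes "0 \<le> \<rho>" "\<rho> < 1"
  shows "\<exists>C\<ge>0. \<forall>d\<ge>1. \<forall>n. (\<Sum>k=d..<n. real k ^ q * \<rho> ^ k) \<le> C * (real d ^ q * \<rho> ^ d)"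
proof -
  let ?f = "\<lambda>j. (1 + real j) ^ q * \<rho> ^ j"
  have summ: "summable ?f"
    using assms by (rule summable_polynomial_geometric)
  have "(\<Sum>k=d..<n. real k ^ q * \<rho> ^ k) \<le> suminf ?f * (real d ^ q * \<rho> ^ d)" if d: "1 \<le> d" for d n
  proof -
    have "(\<Sum>k=d..<n. real k ^ q * \<rho> ^ k) = (\<Sum>j<n - d. real (d + j) ^ q * \<rho> ^ (d + j))"
      using sum.atLeastLessThan_shift_0[of "\<lambda>k. real k ^ q * \<rho> ^ k" d n]
      by (simp add: lessThan_atLeast0)
    also have "\<dots> \<le> (\<Sum>j<n - d. ?f j * (real d ^ q * \<rho> ^ d))"
    proof (rule sum_mono)
      fix j
      have "real (d + j) \<le> (1 + real j) * real d"
        using d mult_left_mono[of 1 "real d" "real j"] by (simp add: algebra_simps)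
      then have "real (d + j) ^ q \<le> ((1 + real j) * real d) ^ q"
        by (intro power_mono) auto
      then show "real (d + j) ^ q * \<rho> ^ (d + j) \<le> ?f j * (real d ^ q * \<rho> ^ d)"
        using mult_right_mono[of "real (d + j) ^ q" "((1 + real j) * real d) ^ q" "\<rho> ^ (d + j)"]
          assms(1)
        by (simp only: power_mult_distrib power_add zero_le_power zero_le_mult_iff mult_ac) simp
    qed
    also have "\<dots> = (\<Sum>j<n - d. ?f j) * (real d ^ q * \<rho> ^ d)"
      by (simp add: sum_distrib_right)
    also have "\<dots> \<le> suminf ?f * (real d ^ q * \<rho> ^ d)"
      using assms(1) by (intro mult_right_mono sum_le_suminf summ) auto
    finally show ?thesis .
  qed
  moreover have "0 \<le> suminf ?f"
    using assms(1) by (intro suminf_nonneg summ) auto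
  ultimately show ?thesis
    by blast
qed

lemma kalman_coeff_bound:
  fixes S :: "('m::finite, 'p::finite, 'r::finite) state_space" and l :: "real^'p \<Rightarrow> real"
  assumes "is_norm l"
    and "\<exists>C\<ge>0. \<forall>k\<ge>N. \<forall>w. norm (matrix_power (closed_loop S P) k *v w) \<le> C * r k * norm w"
    and r: "\<And>k. 0 \<le> r k"
  shows "\<exists>D\<ge>0. \<forall>i j. j + N < i \<longrightarrow> induced_norm l (kalman_coeff S P i j) \<le> D * r (i - j - 1)"
proof -
  let ?Z = "obs_mat S" and ?K = "kalman_gain S P" and ?A = "closed_loop S P"
  obtain C where C: "C \<ge> 0" "\<And>k w. N \<le> k \<Longrightarrow> norm (matrix_power ?A k *v w) \<le> C * r k * norm w"
    using assms(2) by blast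
  obtain a where a: "0 \<le> a" "\<And>w. norm (?Z *v w) \<le> a * norm w"
    using matrix_vector_norm_bound[of ?Z] by blast
  obtain b where b: "0 \<le> b" "\<And>w. norm (?K *v w) \<le> b * norm w"
    using matrix_vector_norm_bound[of ?K] by blast
  obtain c where c: "c \<ge> 0" "\<And>A B. 0 \<le> B \<Longrightarrow> (\<forall>w. norm (A *v w) \<le> B * norm w) \<Longrightarrow>
      induced_norm l A \<le> c * B"
    using induced_norm_bounds(3)[OF assms(1)] by blast
  have "induced_norm l (kalman_coeff S P i j) \<le> c * (a * C * b) * r (i - j - 1)"
    if "j + N < i" for i j
  proof -
    define k where "k = i - j - 1"
    have k: "N \<le> k" and eq: "kalman_coeff S P i j = ?Z ** matrix_power ?A k ** ?K"
      using that by (auto simp: k_def kalman_coeff_def)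
    have "norm (kalman_coeff S P i j *v w) \<le> (a * C * b * r k) * norm w" for w
    proof -
      have "norm (kalman_coeff S P i j *v w) \<le> a * norm (matrix_power ?A k *v (?K *v w))"
        unfolding eq using a(2) by (simp only: matrix_vector_mul_assoc[symmetric])
      also have "\<dots> \<le> a * (C * r k * norm (?K *v w))"
        using a(1) k by (intro mult_left_mono C(2))
      also have "\<dots> \<le> a * (C * r k * (b * norm w))"
        using a(1) b C(1) r by (intro mult_left_mono) auto
      finally show ?thesis
        by (simp add: mult_ac)
    qed
    then have "induced_norm l (kalman_coeff S P i j) \<le> c * (a * C * b * r k)"
      using a b C r by (intro c(2)) auto
    then show ?thesis
      by (simp add: k_def mult_ac)
  qed
  then show ?thesis
    using a b c C by (intro exI[of _ "c * (a * C * b)"] conjI) simp_all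
qed

section \<open>Decoupling of blocks\<close>

lemma tv_dist_ge:
  assumes "prob_space \<mu>" "prob_space \<nu>" "A \<in> sets \<mu>"
  shows "\<bar>measure \<mu> A - measure \<nu> A\<bar> \<le> tv_dist \<mu> \<nu>"
  unfolding tv_dist_def
proof (rule cSUP_upper[OF assms(3)], rule bdd_aboveI2)
  fix B
  show "\<bar>measure \<mu> B - measure \<nu> B\<bar> \<le> 1"
    using prob_space.prob_le_1[OF assms(1), of B] prob_space.prob_le_1[OF assms(2), of B]
      measure_nonneg[of \<mu> B] measure_nonneg[of \<nu> B] by linarith
qed

locale stationary_process = prob_space \<Omega> for \<Omega> :: "'w measure" +
  fixes Y :: "int \<Rightarrow> 'w \<Rightarrow> 'v::topological_space"
  assumes measurable_Y [measurable]: "\<And>i. Y i \<in> borel_measurable \<Omega>"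
    and stationary: "stationary \<Omega> Y"
begin

lemma measurable_segment: "(\<lambda>\<omega>. \<lambda>i\<in>I. Y (i + h) \<omega>) \<in> measurable \<Omega> (path_space I)"
  unfolding path_space_def by (intro measurable_restrict) measurable

text \<open>Stationarity of the law on path space, transferred to functionals of the path.\<close>

lemma distr_shift:
  assumes F: "F \<in> measurable (path_space UNIV) N"
  shows "distr \<Omega> N (\<lambda>\<omega>. F (\<lambda>i. Y (i + h) \<omega>)) = distr \<Omega> N (\<lambda>\<omega>. F (\<lambda>i. Y i \<omega>))"
proof -
  have "distr \<Omega> N (\<lambda>\<omega>. F (\<lambda>i. Y (i + h) \<omega>)) = distr (law_on \<Omega> (\<lambda>i. Y (i + h)) UNIV) N F" for h
    using distr_distr[OF F measurable_segment[where I = UNIV and h = h]]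
    by (simp add: law_on_def o_def restrict_UNIV)
  from this[of h] this[of 0] show ?thesis
    using stationary by (simp add: stationary_def)
qed

lemma prob_space_laws:
  "prob_space (law_on \<Omega> Y I)" "prob_space (joint_law_past_future \<Omega> Y g)"
  using measurable_segment[where h = 0]
  by (auto simp: law_on_def joint_law_past_future_def intro!: prob_space_distr measurable_Pair)

lemma beta_coeff_nonneg: "0 \<le> beta_coeff \<Omega> Y g"
proof -
  interpret past: prob_space "law_on \<Omega> Y {..0}"
    by (rule prob_space_laws)
  interpret future: prob_space "law_on \<Omega> Y {int g..}"
    by (rule prob_space_laws)
  interpret pair_prob_space "law_on \<Omega> Y {..0}" "law_on \<Omega> Y {int g..}" ..
  show ?thesis
    using tv_dist_ge[OF prob_space_axioms prob_space_laws(2) sets.empty_sets, of g]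
    unfolding beta_coeff_def by simp
qed

text \<open>Two functionals, one of the past up to \<open>t\<close> and one of the future from \<open>t + g\<close>, can be treated as
  independent at the cost of \<open>beta_coeff \<Omega> Y g\<close>: pull the event back to the product of the path
  spaces, where the total variation distance applies. Stationarity reduces to \<open>t = 0\<close>.\<close>

lemma decoupling:
  fixes t :: int
  assumes F: "F \<in> borel_measurable (path_space {..0})"
    and G: "G \<in> borel_measurable (path_space {int g..})"
    and B: "B \<in> sets (borel \<Otimes>\<^sub>M borel)"
  defines "U \<equiv> \<lambda>\<omega>. F (\<lambda>i\<in>{..0}. Y (i + t) \<omega>)"
    and "V \<equiv> \<lambda>\<omega>. G (\<lambda>i\<in>{int g..}. Y (i + t) \<omega>)"
  shows "prob {\<omega>\<in>space \<Omega>. (U \<omega>, V \<omega>) \<in> B}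
    \<le> measure (distr \<Omega> borel U \<Otimes>\<^sub>M distr \<Omega> borel V) B + beta_coeff \<Omega> Y g"
proof -
  let ?past = "law_on \<Omega> Y {..0}" and ?future = "law_on \<Omega> Y {int g..}"
  let ?joint = "joint_law_past_future \<Omega> Y g"
  let ?FG = "\<lambda>(x, y). (F x, G y)"
  interpret past: prob_space ?past by (rule prob_space_laws)
  interpret future: prob_space ?future by (rule prob_space_laws)
  interpret pair: pair_prob_space ?past ?future ..
  have seg: "(\<lambda>\<omega>. \<lambda>i\<in>I. Y i \<omega>) \<in> measurable \<Omega> (path_space I)" for I
    using measurable_segment[where h = 0] by simp
  have restr: "(\<lambda>y. restrict y I) \<in> measurable (path_space UNIV) (path_space I)" for I :: "int set"
    unfolding path_space_def by (rule measurable_restrict_subset) simp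
  note F' = measurable_compose[OF restr F] and G' = measurable_compose[OF restr G]
  have FG: "?FG \<in> measurable (path_space {..0} \<Otimes>\<^sub>M path_space {int g..}) (borel \<Otimes>\<^sub>M borel)"
    using F G by measurable
  have sets_past: "sets ?past = sets (path_space {..0})" and sets_future: "sets ?future = sets (path_space {int g..})"
    by (simp_all add: law_on_def)
  have F_past: "F \<in> measurable ?past borel" and G_future: "G \<in> measurable ?future borel"
    using F G by (simp_all add: measurable_cong_sets[OF sets_past refl] measurable_cong_sets[OF sets_future refl])
  have FG_prod: "?FG \<in> measurable (?past \<Otimes>\<^sub>M ?future) (borel \<Otimes>\<^sub>M borel)"
    using F_past G_future by measurable
  have lawU: "distr \<Omega> borel U = distr ?past borel F"
    using distr_shift[OF F', of t] distr_distr[OF F seg]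
    by (simp add: U_def law_on_def o_def)
  have lawV: "distr \<Omega> borel V = distr ?future borel G"
    using distr_shift[OF G', of t] distr_distr[OF G seg]
    by (simp add: V_def law_on_def o_def)
  have "(\<lambda>y. (F (restrict y {..0}), G (restrict y {int g..}))) \<in> measurable (path_space UNIV) (borel \<Otimes>\<^sub>M borel)"
    using F' G' by measurable
  from distr_shift[OF this, of t]
  have lawUV: "distr \<Omega> (borel \<Otimes>\<^sub>M borel) (\<lambda>\<omega>. (U \<omega>, V \<omega>)) = distr ?joint (borel \<Otimes>\<^sub>M borel) ?FG"
    using distr_distr[OF FG measurable_Pair[OF seg seg]]
    by (simp add: U_def V_def joint_law_past_future_def o_def)
  have "(\<lambda>\<omega>. (U \<omega>, V \<omega>)) \<in> measurable \<Omega> (borel \<Otimes>\<^sub>M borel)"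
    unfolding U_def V_def
    using measurable_compose[OF measurable_segment F] measurable_compose[OF measurable_segment G]
    by (intro measurable_Pair)
  then have "prob {\<omega>\<in>space \<Omega>. (U \<omega>, V \<omega>) \<in> B}
      = measure (distr \<Omega> (borel \<Otimes>\<^sub>M borel) (\<lambda>\<omega>. (U \<omega>, V \<omega>))) B"
    using B by (subst measure_distr) (auto intro!: arg_cong[where f = prob])
  define A where "A = ?FG -` B \<inter> space (?past \<Otimes>\<^sub>M ?future)"
  have space_joint: "space ?joint = space (?past \<Otimes>\<^sub>M ?future)"
    by (simp add: joint_law_past_future_def space_pair_measure law_on_def)
  have FG_joint: "?FG \<in> measurable ?joint (borel \<Otimes>\<^sub>M borel)"
    using FG by (simp add: joint_law_past_future_def)
  have A: "A \<in> sets (?past \<Otimes>\<^sub>M ?future)"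
    unfolding A_def by (rule measurable_sets[OF FG_prod B])
  have "prob {\<omega>\<in>space \<Omega>. (U \<omega>, V \<omega>) \<in> B} = measure ?joint A"
    unfolding \<open>prob _ = _\<close> lawUV A_def space_joint[symmetric] by (rule measure_distr[OF FG_joint B])
  moreover have "distr \<Omega> borel U \<Otimes>\<^sub>M distr \<Omega> borel V
      = distr (?past \<Otimes>\<^sub>M ?future) (borel \<Otimes>\<^sub>M borel) ?FG"
    unfolding lawU lawV
    by (intro pair_measure_distr F_past G_future prob_space_imp_sigma_finite future.prob_space_distr)
  then have "measure (distr \<Omega> borel U \<Otimes>\<^sub>M distr \<Omega> borel V) B = measure (?past \<Otimes>\<^sub>M ?future) A"
    unfolding A_def using measure_distr[OF FG_prod B] by simp
  moreover have "\<bar>measure (?past \<Otimes>\<^sub>M ?future) A - measure ?joint A\<bar> \<le> beta_coeff \<Omega> Y g"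
    unfolding beta_coeff_def by (rule tv_dist_ge[OF pair.prob_space_axioms prob_space_laws(2) A])
  ultimately show ?thesis
    by linarith
qed

end

text \<open>A functional \<open>\<phi>\<close> that sees only the present and the last \<open>d\<close> values of a path.\<close>

locale windowed_process = stationary_process \<Omega> Y for \<Omega> :: "'w measure" and Y :: "int \<Rightarrow> 'w \<Rightarrow> 'v::topological_space" +
  fixes \<phi> :: "(int \<Rightarrow> 'v) \<Rightarrow> real" and d :: nat
  assumes measurable_\<phi>: "\<phi> \<in> borel_measurable (path_space {- int d..0})"
    and \<phi>_restrict: "\<And>y. \<phi> (restrict y {- int d..0}) = \<phi> y"
begin

definition window_at :: "nat \<Rightarrow> 'w \<Rightarrow> real" where
  "window_at i \<omega> = \<phi> (\<lambda>m. Y (int i + m) \<omega>)"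

lemma measurable_window_sum:
  assumes "\<And>i. i \<in> I \<Longrightarrow> \<forall>m\<in>{- int d..0}. int i - t + m \<in> J"
  shows "(\<lambda>p. \<Sum>i\<in>I. \<phi> (\<lambda>m\<in>{- int d..0}. p (int i - t + m))) \<in> borel_measurable (path_space J)"
proof (intro borel_measurable_sum measurable_compose[OF _ measurable_\<phi>])
  fix i assume "i \<in> I"
  then show "(\<lambda>p. \<lambda>m\<in>{- int d..0}. p (int i - t + m)) \<in> measurable (path_space J) (path_space {- int d..0})"
    unfolding path_space_def using assms
    by (intro measurable_restrict measurable_component_singleton) auto
qed

text \<open>Expresses the functional at time \<open>i\<close> through a path segment that is shifted by \<open>t\<close> and restricted to
  a past or future time set \<open>J\<close>.\<close>

lemma window_at_eq_shifted_window:
  assumes "\<forall>m\<in>{- int d..0}. int i - t + m \<in> J"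
  shows "\<phi> (\<lambda>m\<in>{- int d..0}. (\<lambda>k\<in>J. Y (k + t) \<omega>) (int i - t + m)) = window_at i \<omega>"
proof -
  have "(\<lambda>m\<in>{- int d..0}. (\<lambda>k\<in>J. Y (k + t) \<omega>) (int i - t + m))
      = restrict (\<lambda>m. Y (int i + m) \<omega>) {- int d..0}"
    using assms by (auto simp: restrict_def fun_eq_iff)
  then show ?thesis
    by (simp add: window_at_def \<phi>_restrict)
qed

lemma measurable_window_at [measurable]: "window_at i \<in> borel_measurable \<Omega>"
proof -
  have "(\<lambda>\<omega>. \<phi> (\<lambda>m\<in>{- int d..0}. Y (m + int i) \<omega>)) \<in> borel_measurable \<Omega>"
    by (rule measurable_compose[OF measurable_segment measurable_\<phi>])
  then show ?thesis
    by (simp add: window_at_def[abs_def] \<phi>_restrict add.commute)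
qed

lemma distr_window_at: "distr \<Omega> borel (window_at i) = distr \<Omega> borel (window_at j)"
proof -
  have "\<phi> \<in> borel_measurable (path_space UNIV)"
    using measurable_compose[OF measurable_restrict_subset measurable_\<phi>[unfolded path_space_def], of UNIV]
    by (simp add: \<phi>_restrict path_space_def)
  from distr_shift[OF this, of "int i"] distr_shift[OF this, of "int j"] show ?thesis
    by (simp add: window_at_def[abs_def] add.commute)
qed

text \<open>A window that ends at \<open>j \<ge> t + g + d\<close> begins at or after \<open>t + g\<close>.\<close>

lemma decoupling_blocks:
  fixes t :: int
  assumes "\<And>i. i \<in> I \<Longrightarrow> int i \<le> t" "\<And>j. j \<in> J \<Longrightarrow> t + int g + int d \<le> int j"
    and B: "B \<in> sets (borel \<Otimes>\<^sub>M borel)"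
  defines "U \<equiv> \<lambda>\<omega>. \<Sum>i\<in>I. window_at i \<omega>" and "V \<equiv> \<lambda>\<omega>. \<Sum>j\<in>J. window_at j \<omega>"
  shows "prob {\<omega>\<in>space \<Omega>. (U \<omega>, V \<omega>) \<in> B}
    \<le> measure (distr \<Omega> borel U \<Otimes>\<^sub>M distr \<Omega> borel V) B + beta_coeff \<Omega> Y g"
proof -
  have past: "\<forall>m\<in>{- int d..0}. int i - t + m \<in> {..0}" if "i \<in> I" for i
    using assms(1)[OF that] by auto
  have future: "\<forall>m\<in>{- int d..0}. int j - t + m \<in> {int g..}" if "j \<in> J" for j
    using assms(2)[OF that] by auto
  have U: "U = (\<lambda>\<omega>. \<Sum>i\<in>I. \<phi> (\<lambda>m\<in>{- int d..0}. (\<lambda>k\<in>{..0}. Y (k + t) \<omega>) (int i - t + m)))"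
    unfolding U_def by (intro ext sum.cong refl window_at_eq_shifted_window[OF past, symmetric])
  have V: "V = (\<lambda>\<omega>. \<Sum>j\<in>J. \<phi> (\<lambda>m\<in>{- int d..0}. (\<lambda>k\<in>{int g..}. Y (k + t) \<omega>) (int j - t + m)))"
    unfolding V_def by (intro ext sum.cong refl window_at_eq_shifted_window[OF future, symmetric])
  show ?thesis
    unfolding U V
    by (rule decoupling[OF measurable_window_sum[OF past] measurable_window_sum[OF future] B])
qed

end

section \<open>Lower tail of block averages\<close>

text \<open>Since \<open>exp x \<ge> 1 + x + x\<^sup>2 / 2\<close> and \<open>(1 - x + x\<^sup>2 / 2) * (1 + x + x\<^sup>2 / 2) = 1 + x\<^sup>4 / 4\<close>.\<close>

lemma exp_neg_le_quadratic:
  fixes x :: real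
  assumes "0 \<le> x"
  shows "exp (- x) \<le> 1 - x + x\<^sup>2 / 2"
proof -
  have pos: "0 < 1 - x + x\<^sup>2 / 2"
    using zero_le_power2[of "x - 1"] by (simp add: power2_diff)
  have "(1 - x + x\<^sup>2 / 2) * (1 + x + x\<^sup>2 / 2) = 1 + (x\<^sup>2)\<^sup>2 / 4"
    by (simp add: algebra_simps power2_eq_square)
  then have "1 \<le> (1 - x + x\<^sup>2 / 2) * (1 + x + x\<^sup>2 / 2)"
    by simp
  also have "\<dots> \<le> (1 - x + x\<^sup>2 / 2) * exp x"
    using exp_lower_Taylor_quadratic[OF assms] pos by (intro mult_left_mono) auto
  finally show ?thesis
    by (simp add: exp_minus field_simps)
qed

text \<open>Every other block of length \<open>a\<close>, starting from \<open>s\<close>. The starting points \<open>s\<close> and \<open>s + a\<close> give the two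
  parities.\<close>

definition alternate_blocks :: "nat \<Rightarrow> nat \<Rightarrow> nat \<Rightarrow> nat set" where
  "alternate_blocks a s m = (\<Union>k<m. {s + 2 * k * a..<s + 2 * k * a + a})"

lemma sum_alternate_blocks_Suc:
  "sum f (alternate_blocks a s (Suc m))
    = sum f (alternate_blocks a s m) + sum f {s + 2 * m * a..<s + 2 * m * a + a}"
proof -
  have "k * a + a \<le> m * a" if "k < m" for k
    using that mult_le_mono1[of "Suc k" m a] by simp
  then have "alternate_blocks a s m \<inter> {s + 2 * m * a..<s + 2 * m * a + a} = {}"
    unfolding alternate_blocks_def by fastforce
  then show ?thesis
    unfolding alternate_blocks_def lessThan_Suc UN_insert
    by (subst sum.union_disjoint) (auto simp: add.commute)
qed

lemma sum_two_alternate_blocks: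
  "sum f (alternate_blocks a s m) + sum f (alternate_blocks a (s + a) m) = sum f {s..<s + 2 * m * a}"
  for f :: "nat \<Rightarrow> 'a::comm_monoid_add"
proof (induction m)
  case 0
  show ?case
    by (simp add: alternate_blocks_def)
next
  case (Suc m)
  let ?t = "s + 2 * m * a"
  have "sum f {s..<s + 2 * Suc m * a} = sum f {s..<?t} + (sum f {?t..<?t + a} + sum f {?t + a..<?t + a + a})"
    by (simp add: sum.atLeastLessThan_concat algebra_simps)
  also note Suc.IH[symmetric]
  finally show ?case
    by (simp add: sum_alternate_blocks_Suc algebra_simps)
qed

context windowed_process
begin

context
  fixes M :: real
  assumes \<phi>_nonneg: "\<And>y. 0 \<le> \<phi> y"
    and square_integrable: "integrable \<Omega> (\<lambda>\<omega>. (window_at 0 \<omega>)\<^sup>2)"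
    and second_moment: "(\<integral>\<omega>. (window_at 0 \<omega>)\<^sup>2 \<partial>\<Omega>) \<le> M\<^sup>2"
begin

lemma window_at_nonneg: "0 \<le> window_at i \<omega>"
  by (simp add: window_at_def \<phi>_nonneg)

lemma integrable_window_at: "integrable \<Omega> (window_at 0)"
  using square_integrable by (rule square_integrable_imp_integrable[rotated]) measurable

text \<open>Nonnegativity makes the quadratic bound for \<open>exp (- x)\<close> available, and with it a sub-Gaussian
  Laplace transform on the negative side from the second moment alone.\<close>

lemma laplace_transform_window_at:
  assumes "0 \<le> \<xi>"
  shows "integrable \<Omega> (\<lambda>\<omega>. exp (- (\<xi> * window_at i \<omega>)))"
    and "expectation (\<lambda>\<omega>. exp (- (\<xi> * window_at i \<omega>))) \<le> exp (- \<xi> * expectation (window_at 0) + \<xi>\<^sup>2 * M\<^sup>2 / 2)"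
proof -
  have int: "integrable \<Omega> (\<lambda>\<omega>. exp (- (\<xi> * window_at i \<omega>)))" for i
    using assms window_at_nonneg by (intro integrable_const_bound[where B = 1]) auto
  then show "integrable \<Omega> (\<lambda>\<omega>. exp (- (\<xi> * window_at i \<omega>)))" .
  have "expectation (\<lambda>\<omega>. exp (- (\<xi> * window_at i \<omega>))) = integral\<^sup>L (distr \<Omega> borel (window_at i)) (\<lambda>x. exp (- (\<xi> * x)))"
    by (subst integral_distr) auto
  also have "\<dots> = expectation (\<lambda>\<omega>. exp (- (\<xi> * window_at 0 \<omega>)))"
    unfolding distr_window_at[of i 0] by (subst integral_distr) auto
  also have "\<dots> \<le> expectation (\<lambda>\<omega>. 1 - \<xi> * window_at 0 \<omega> + \<xi>\<^sup>2 / 2 * (window_at 0 \<omega>)\<^sup>2)"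
  proof (rule integral_mono)
    show "integrable \<Omega> (\<lambda>\<omega>. 1 - \<xi> * window_at 0 \<omega> + \<xi>\<^sup>2 / 2 * (window_at 0 \<omega>)\<^sup>2)"
      using integrable_window_at square_integrable by simp
    show "exp (- (\<xi> * window_at 0 \<omega>)) \<le> 1 - \<xi> * window_at 0 \<omega> + \<xi>\<^sup>2 / 2 * (window_at 0 \<omega>)\<^sup>2" for \<omega>
      using exp_neg_le_quadratic[of "\<xi> * window_at 0 \<omega>"] assms window_at_nonneg by (simp add: power_mult_distrib)
  qed (rule int)
  also have "\<dots> = 1 - \<xi> * expectation (window_at 0) + \<xi>\<^sup>2 / 2 * expectation (\<lambda>\<omega>. (window_at 0 \<omega>)\<^sup>2)"
    using integrable_window_at square_integrable by (simp add: prob_space)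
  also have "\<dots> \<le> 1 + (- \<xi> * expectation (window_at 0) + \<xi>\<^sup>2 * M\<^sup>2 / 2)"
    using mult_left_mono[OF second_moment, of "\<xi>\<^sup>2 / 2"] by simp
  also have "\<dots> \<le> exp (- \<xi> * expectation (window_at 0) + \<xi>\<^sup>2 * M\<^sup>2 / 2)"
    by (rule exp_ge_add_one_self)
  finally show "expectation (\<lambda>\<omega>. exp (- (\<xi> * window_at i \<omega>)))
      \<le> exp (- \<xi> * expectation (window_at 0) + \<xi>\<^sup>2 * M\<^sup>2 / 2)" .
qed

text \<open>By convexity of the exponential function the average over a block has at most the Laplace transform of
  a single summand, however strongly the summands depend on each other.\<close>

lemma laplace_transform_block:
  assumes "0 \<le> \<xi>" "finite J" "J \<noteq> {}"
  defines "V \<equiv> \<lambda>\<omega>. \<Sum>j\<in>J. window_at j \<omega>"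
  shows "integrable \<Omega> (\<lambda>\<omega>. exp (- (\<xi> / card J * V \<omega>)))"
    and "expectation (\<lambda>\<omega>. exp (- (\<xi> / card J * V \<omega>)))
      \<le> exp (- \<xi> * expectation (window_at 0) + \<xi>\<^sup>2 * M\<^sup>2 / 2)"
proof -
  have card: "0 < card J"
    using assms by (simp add: card_gt_0_iff)
  have V_nonneg: "0 \<le> V \<omega>" for \<omega>
    unfolding V_def by (intro sum_nonneg window_at_nonneg)
  have [measurable]: "V \<in> borel_measurable \<Omega>"
    unfolding V_def by measurable
  show int: "integrable \<Omega> (\<lambda>\<omega>. exp (- (\<xi> / card J * V \<omega>)))"
    using assms(1) V_nonneg by (intro integrable_const_bound[where B = 1]) auto
  have "expectation (\<lambda>\<omega>. exp (- (\<xi> / card J * V \<omega>)))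
      \<le> expectation (\<lambda>\<omega>. \<Sum>j\<in>J. 1 / card J * exp (- (\<xi> * window_at j \<omega>)))"
  proof (rule integral_mono[OF int])
    show "integrable \<Omega> (\<lambda>\<omega>. \<Sum>j\<in>J. 1 / card J * exp (- (\<xi> * window_at j \<omega>)))"
      using laplace_transform_window_at(1)[OF assms(1)]
      by (intro Bochner_Integration.integrable_sum integrable_mult_right)
    fix \<omega>
    have "exp (\<Sum>j\<in>J. (1 / card J) *\<^sub>R (- (\<xi> * window_at j \<omega>))) \<le> (\<Sum>j\<in>J. 1 / card J * exp (- (\<xi> * window_at j \<omega>)))"
      using card by (intro convex_on_sum[OF assms(2,3) exp_convex]) auto
    then show "exp (- (\<xi> / card J * V \<omega>)) \<le> (\<Sum>j\<in>J. 1 / card J * exp (- (\<xi> * window_at j \<omega>)))"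
      by (simp add: V_def sum_negf sum_distrib_left)
  qed
  also have "\<dots> = (\<Sum>j\<in>J. 1 / card J * expectation (\<lambda>\<omega>. exp (- (\<xi> * window_at j \<omega>))))"
    using laplace_transform_window_at(1)[OF assms(1)] by (subst Bochner_Integration.integral_sum) auto
  also have "\<dots> \<le> (\<Sum>j\<in>J. 1 / card J * exp (- \<xi> * expectation (window_at 0) + \<xi>\<^sup>2 * M\<^sup>2 / 2))"
    by (intro sum_mono mult_left_mono laplace_transform_window_at(2) assms(1)) auto
  also have "\<dots> = exp (- \<xi> * expectation (window_at 0) + \<xi>\<^sup>2 * M\<^sup>2 / 2)"
    using card by simp
  finally show "expectation (\<lambda>\<omega>. exp (- (\<xi> / card J * V \<omega>)))
      \<le> exp (- \<xi> * expectation (window_at 0) + \<xi>\<^sup>2 * M\<^sup>2 / 2)" .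
qed

text \<open>Chernoff bound for dependent blocks, by induction on their number: decouple the last block, condition on
  its value \<open>y\<close>, and use the induction hypothesis at level \<open>c - y\<close>. Stating the bound at every level \<open>c\<close>
  keeps the decoupling error additive instead of multiplied by \<open>exp (\<xi> / a * c)\<close>, and only products of
  two laws occur.\<close>

lemma lower_tail_alternate_blocks:
  assumes "0 \<le> \<xi>" "d < a"
  shows "prob {\<omega>\<in>space \<Omega>. (\<Sum>i\<in>alternate_blocks a s m. window_at i \<omega>) \<le> c}
    \<le> exp (\<xi> / a * c) * exp (- \<xi> * expectation (window_at 0) + \<xi>\<^sup>2 * M\<^sup>2 / 2) ^ m
      + m * beta_coeff \<Omega> Y (a - d)"
proof (induction m arbitrary: c)
  case 0
  show ?case
  proof (cases "0 \<le> c")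
    case True
    have "prob {\<omega>\<in>space \<Omega>. (\<Sum>i\<in>alternate_blocks a s 0. window_at i \<omega>) \<le> c} \<le> 1"
      by (rule prob_le_1)
    also have "1 \<le> exp (\<xi> / a * c)"
      using assms(1) True by simp
    finally show ?thesis
      by simp
  qed (simp add: alternate_blocks_def)
next
  case (Suc m)
  define \<kappa> \<beta> L where defs: "\<kappa> = \<xi> / a" "\<beta> = beta_coeff \<Omega> Y (a - d)"
    "L = exp (- \<xi> * expectation (window_at 0) + \<xi>\<^sup>2 * M\<^sup>2 / 2)"
  define I where "I = alternate_blocks a s m"
  define J where "J = {s + 2 * m * a..<s + 2 * m * a + a}"
  define U V where UV: "U = (\<lambda>\<omega>. \<Sum>i\<in>I. window_at i \<omega>)" "V = (\<lambda>\<omega>. \<Sum>j\<in>J. window_at j \<omega>)"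
  have [measurable]: "U \<in> borel_measurable \<Omega>" "V \<in> borel_measurable \<Omega>"
    unfolding UV by measurable
  interpret U: prob_space "distr \<Omega> borel U"
    by (rule prob_space_distr) measurable
  interpret V: prob_space "distr \<Omega> borel V"
    by (rule prob_space_distr) measurable
  interpret UV: pair_prob_space "distr \<Omega> borel U" "distr \<Omega> borel V" ..
  let ?B = "{p :: real \<times> real. fst p + snd p \<le> c}"
  have B: "?B \<in> sets (borel \<Otimes>\<^sub>M borel)"
  proof -
    have "{p \<in> space (borel \<Otimes>\<^sub>M borel). fst p + snd p \<le> c} \<in> sets (borel \<Otimes>\<^sub>M borel)"
      by measurable
    then show ?thesis
      by (simp add: space_pair_measure)
  qed
  have card: "card J = a" "finite J" "J \<noteq> {}"
    using assms(2) by (auto simp: J_def)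
  have int: "integrable \<Omega> (\<lambda>\<omega>. exp (- (\<kappa> * V \<omega>)))"
    and laplace: "expectation (\<lambda>\<omega>. exp (- (\<kappa> * V \<omega>))) \<le> L"
    using laplace_transform_block[OF assms(1) card(2,3)] by (simp_all add: card(1) defs UV)
  let ?h = "\<lambda>y. exp (\<kappa> * c) * L ^ m * exp (- (\<kappa> * y)) + m * \<beta>"
  have int_h: "integrable \<Omega> (\<lambda>\<omega>. ?h (V \<omega>))"
    using int by simp
  have h_nonneg: "0 \<le> ?h y" for y
    unfolding defs by (intro add_nonneg_nonneg mult_nonneg_nonneg beta_coeff_nonneg) auto
  have "emeasure (distr \<Omega> borel U \<Otimes>\<^sub>M distr \<Omega> borel V) ?B
      = (\<integral>\<^sup>+y. emeasure (distr \<Omega> borel U) ((\<lambda>x. (x, y)) -` ?B) \<partial>distr \<Omega> borel V)"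
    using B by (intro UV.emeasure_pair_measure_alt2) (simp add: sets_pair_measure_cong[OF sets_distr sets_distr])
  also have "\<dots> \<le> (\<integral>\<^sup>+y. ennreal (?h y) \<partial>distr \<Omega> borel V)"
  proof (rule nn_integral_mono)
    fix y
    have "emeasure (distr \<Omega> borel U) ((\<lambda>x. (x, y)) -` ?B) = prob {\<omega>\<in>space \<Omega>. U \<omega> \<le> c - y}"
      by (subst emeasure_distr)
        (auto simp: emeasure_eq_measure algebra_simps vimage_def intro!: arg_cong[where f = prob])
    also have "prob {\<omega>\<in>space \<Omega>. U \<omega> \<le> c - y} \<le> ?h y"
    proof -
      have "exp (\<kappa> * (c - y)) = exp (\<kappa> * c) * exp (- (\<kappa> * y))"
        by (simp add: right_diff_distrib flip: exp_add)
      then show ?thesis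
        using Suc.IH[of "c - y"] unfolding UV I_def defs by (simp only: mult_ac)
    qed
    finally show "emeasure (distr \<Omega> borel U) ((\<lambda>x. (x, y)) -` ?B) \<le> ennreal (?h y)"
      by (simp add: ennreal_leI)
  qed
  also have "\<dots> = (\<integral>\<^sup>+\<omega>. ennreal (?h (V \<omega>)) \<partial>\<Omega>)"
    by (subst nn_integral_distr) auto
  also have "\<dots> = ennreal (expectation (\<lambda>\<omega>. ?h (V \<omega>)))"
    using int_h h_nonneg by (intro nn_integral_eq_integral) auto
  finally have "measure (distr \<Omega> borel U \<Otimes>\<^sub>M distr \<Omega> borel V) ?B \<le> expectation (\<lambda>\<omega>. ?h (V \<omega>))"
    using h_nonneg by (simp add: UV.emeasure_eq_measure ennreal_le_iff integral_nonneg_AE)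
  also have "\<dots> = exp (\<kappa> * c) * L ^ m * expectation (\<lambda>\<omega>. exp (- (\<kappa> * V \<omega>))) + m * \<beta>"
    using int by (simp add: prob_space)
  also have "\<dots> \<le> exp (\<kappa> * c) * L ^ m * L + m * \<beta>"
    using laplace by (intro add_right_mono mult_left_mono) (auto simp: defs)
  also have "\<dots> = exp (\<kappa> * c) * L ^ Suc m + m * \<beta>"
    by simp
  finally have product: "measure (distr \<Omega> borel U \<Otimes>\<^sub>M distr \<Omega> borel V) ?B \<le> exp (\<kappa> * c) * L ^ Suc m + m * \<beta>" .
  have "prob {\<omega>\<in>space \<Omega>. (U \<omega>, V \<omega>) \<in> ?B} \<le> measure (distr \<Omega> borel U \<Otimes>\<^sub>M distr \<Omega> borel V) ?B + \<beta>"
    unfolding UV defs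
  \<comment> \<open>The previous block of the same parity ends before \<open>t\<close>, one block length before the new one begins;
      integers keep \<open>t\<close> meaningful for \<open>m = 0\<close>.\<close>
  proof (rule decoupling_blocks[where t = "int (s + 2 * m * a) - int a", OF _ _ B])
    fix i assume "i \<in> I"
    then obtain k where k: "k < m" "i < s + 2 * k * a + a"
      by (auto simp: I_def alternate_blocks_def)
    have "Suc k * a \<le> m * a"
      using k by (intro mult_le_mono1) auto
    then have "i + a \<le> s + 2 * m * a"
      using k by simp
    then show "int i \<le> int (s + 2 * m * a) - int a"
      by (simp only: le_diff_eq of_nat_add[symmetric] of_nat_le_iff)
  next
    fix j assume "j \<in> J"
    then have "s + 2 * m * a \<le> j"
      by (simp add: J_def)
    moreover have "int (s + 2 * m * a) - int a + int (a - d) + int d = int (s + 2 * m * a)"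
      using assms(2) by simp
    ultimately show "int (s + 2 * m * a) - int a + int (a - d) + int d \<le> int j"
      by (simp only: of_nat_le_iff)
  qed
  also have "\<dots> \<le> exp (\<kappa> * c) * L ^ Suc m + Suc m * \<beta>"
    using product by (simp add: algebra_simps)
  also have "{\<omega>\<in>space \<Omega>. (U \<omega>, V \<omega>) \<in> ?B} = {\<omega>\<in>space \<Omega>. (\<Sum>i\<in>alternate_blocks a s (Suc m). window_at i \<omega>) \<le> c}"
    by (simp add: UV I_def J_def sum_alternate_blocks_Suc)
  finally show ?case
    by (simp add: defs)
qed

text \<open>If the average over all times is too small, then so is the average over one of the two parities. The
  parameter \<open>\<xi> = \<tau> / M\<^sup>2\<close> optimizes the Chernoff bound.\<close>

lemma lower_tail_training_average:
  fixes \<mu> a s :: nat and \<tau> :: real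
  assumes "d < a" "0 < \<mu>" "0 \<le> \<tau>" "0 < M"
  defines "N \<equiv> 2 * \<mu> * a"
  shows "prob {\<omega>\<in>space \<Omega>. 1 / real N * (\<Sum>i\<in>{s..<s + N}. window_at i \<omega>) < expectation (window_at 0) - \<tau>}
    \<le> 2 * exp (- (\<mu> * \<tau>\<^sup>2 / (2 * M\<^sup>2))) + 2 * \<mu> * beta_coeff \<Omega> Y (a - d)"
proof -
  define c where "c = \<mu> * a * (expectation (window_at 0) - \<tau>)"
  let ?S = "\<lambda>s \<omega>. \<Sum>i\<in>alternate_blocks a s \<mu>. window_at i \<omega>"
  have N: "0 < N"
    using assms by simp
  have half: "prob {\<omega>\<in>space \<Omega>. ?S s \<omega> \<le> c} \<le> exp (- (\<mu> * \<tau>\<^sup>2 / (2 * M\<^sup>2))) + \<mu> * beta_coeff \<Omega> Y (a - d)"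
    for s
  proof -
    define \<xi> where "\<xi> = \<tau> / M\<^sup>2"
    have \<xi>: "\<xi> * M\<^sup>2 = \<tau>" "0 \<le> \<xi>"
      using assms by (auto simp: \<xi>_def)
    have "prob {\<omega>\<in>space \<Omega>. ?S s \<omega> \<le> c}
        \<le> exp (\<xi> / a * c) * exp (- \<xi> * expectation (window_at 0) + \<xi>\<^sup>2 * M\<^sup>2 / 2) ^ \<mu> + \<mu> * beta_coeff \<Omega> Y (a - d)"
      using \<xi>(2) assms(1) by (rule lower_tail_alternate_blocks)
    also have "exp (\<xi> / a * c) * exp (- \<xi> * expectation (window_at 0) + \<xi>\<^sup>2 * M\<^sup>2 / 2) ^ \<mu>
        = exp (\<xi> / a * c + \<mu> * (- \<xi> * expectation (window_at 0) + \<xi>\<^sup>2 * M\<^sup>2 / 2))"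
      by (simp only: exp_of_nat_mult exp_add)
    also have "\<xi> / a * c = \<xi> * \<mu> * (expectation (window_at 0) - \<tau>)"
      using assms(1) by (simp add: c_def)
    also have "\<xi> * \<mu> * (expectation (window_at 0) - \<tau>) + \<mu> * (- \<xi> * expectation (window_at 0) + \<xi>\<^sup>2 * M\<^sup>2 / 2)
        = \<mu> * (\<xi> * (\<xi> * M\<^sup>2) / 2 - \<xi> * \<tau>)"
      by (simp add: algebra_simps power2_eq_square)
    also have "\<dots> = - (\<mu> * \<tau>\<^sup>2 / (2 * M\<^sup>2))"
      unfolding \<xi>(1) using assms(4) by (simp add: \<xi>_def power2_eq_square field_simps)
    finally show ?thesis .
  qed
  have "prob {\<omega>\<in>space \<Omega>. 1 / real N * (\<Sum>i\<in>{s..<s + N}. window_at i \<omega>) < expectation (window_at 0) - \<tau>}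
      \<le> prob ({\<omega>\<in>space \<Omega>. ?S s \<omega> \<le> c} \<union> {\<omega>\<in>space \<Omega>. ?S (s + a) \<omega> \<le> c})"
  proof (rule finite_measure_mono)
    show "{\<omega>\<in>space \<Omega>. 1 / real N * (\<Sum>i\<in>{s..<s + N}. window_at i \<omega>) < expectation (window_at 0) - \<tau>}
        \<subseteq> {\<omega>\<in>space \<Omega>. ?S s \<omega> \<le> c} \<union> {\<omega>\<in>space \<Omega>. ?S (s + a) \<omega> \<le> c}"
    proof
      fix \<omega>
      assume \<omega>: "\<omega> \<in> {\<omega>\<in>space \<Omega>. 1 / real N * (\<Sum>i\<in>{s..<s + N}. window_at i \<omega>) < expectation (window_at 0) - \<tau>}"
      then have "(\<Sum>i\<in>{s..<s + N}. window_at i \<omega>) < real N * (expectation (window_at 0) - \<tau>)"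
        using N by (simp add: field_simps)
      then have "?S s \<omega> + ?S (s + a) \<omega> < 2 * c"
        unfolding N_def by (simp add: sum_two_alternate_blocks c_def mult.assoc)
      then show "\<omega> \<in> {\<omega>\<in>space \<Omega>. ?S s \<omega> \<le> c} \<union> {\<omega>\<in>space \<Omega>. ?S (s + a) \<omega> \<le> c}"
        using \<omega> by auto
    qed
  qed measurable
  also have "\<dots> \<le> prob {\<omega>\<in>space \<Omega>. ?S s \<omega> \<le> c} + prob {\<omega>\<in>space \<Omega>. ?S (s + a) \<omega> \<le> c}"
    by (rule measure_Un_le) measurable
  finally show ?thesis
    using half[of s] half[of "s + a"] by (simp add: algebra_simps)
qed

end

end

section \<open>Truncation of the Kalman predictor\<close>

text \<open>The two predictions differ by the terms that are more than \<open>d\<close> steps old, and \<open>l\<close> is Lipschitz with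
  constant \<open>1\<close> with respect to itself.\<close>

lemma truncation_loss_difference:
  assumes "is_norm l" "d < i"
  shows "\<bar>l (y i - (\<Sum>j=i-d..i-1. kalman_coeff S P i j *v y j)) - l (y i - (\<Sum>j=1..i-1. kalman_coeff S P i j *v y j))\<bar>
    \<le> (\<Sum>j=1..i-d-1. induced_norm l (kalman_coeff S P i j) * l (y j))"
proof -
  let ?f = "\<lambda>j. kalman_coeff S P i j *v y j"
  have "{1..i-1} = {1..i-d-1} \<union> {i-d..i-1}"
    using assms(2) by auto
  then have "sum ?f {1..i-1} = sum ?f {1..i-d-1} + sum ?f {i-d..i-1}"
    by (simp add: sum.union_disjoint)
  then have "(y i - sum ?f {i-d..i-1}) - (y i - sum ?f {1..i-1}) = sum ?f {1..i-d-1}"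
    by simp
  with is_norm_reverse_triangle[OF assms(1), of "y i - sum ?f {i-d..i-1}" "y i - sum ?f {1..i-1}"]
  have "\<bar>l (y i - sum ?f {i-d..i-1}) - l (y i - sum ?f {1..i-1})\<bar> \<le> l (sum ?f {1..i-d-1})"
    by (simp only:)
  also have "\<dots> \<le> (\<Sum>j=1..i-d-1. l (?f j))"
    by (rule is_norm_sum[OF assms(1)]) simp
  also have "\<dots> \<le> (\<Sum>j=1..i-d-1. induced_norm l (kalman_coeff S P i j) * l (y j))"
    by (intro sum_mono induced_norm_bounds(1) assms(1))
  finally show ?thesis .
qed

text \<open>The loss of the truncated predictor at time \<open>0\<close> as a functional of a path: \<open>truncated_predictor\<close>
  reads its window at positions \<open>1, \<dots>, d\<close>, which are the times \<open>- d, \<dots>, - 1\<close>.\<close>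

definition window_loss ::
  "(real^'p \<Rightarrow> real) \<Rightarrow> ('m::finite, 'p::finite, 'r::finite) state_space \<Rightarrow> real^'m^'m \<Rightarrow> nat
    \<Rightarrow> (int \<Rightarrow> real^'p) \<Rightarrow> real" where
  "window_loss l S P d y = l (y 0 - truncated_predictor S P d (\<lambda>j. y (int j - int d - 1)))"

lemma window_loss_eq:
  assumes "d < i"
  shows "window_loss l S P d (\<lambda>m. y (int i + m))
    = l (y (int i) - (\<Sum>j=i-d..i-1. kalman_coeff S P i j *v y (int j)))"
proof -
  have "(\<Sum>j=1..d. kalman_coeff S P (d + 1) j *v y (int i + (int j - int d - 1)))
      = (\<Sum>j=i-d..i-1. kalman_coeff S P i j *v y (int j))"
  proof (rule sum.reindex_bij_witness[where i = "\<lambda>j. j + d + 1 - i" and j = "\<lambda>j. i + j - d - 1"])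
    fix j assume "j \<in> {1..d}"
    then have "int (i + j - d - 1) = int i + (int j - int d - 1)"
      "i - (i + j - d - 1) - 1 = d + 1 - j - 1" "i + j - d - 1 < i" "j < d + 1"
      using assms by auto
    then show "kalman_coeff S P i (i + j - d - 1) *v y (int (i + j - d - 1))
        = kalman_coeff S P (d + 1) j *v y (int i + (int j - int d - 1))"
      by (simp only: kalman_coeff_def if_True)
  qed (use assms in auto)
  then show ?thesis
    by (simp add: window_loss_def truncated_predictor_def)
qed

text \<open>After exactly \<open>d\<close> observations the full and the truncated predictor coincide; this carries the
  moment assumption over to the truncated loss.\<close>

lemma loss_at_eq_window_loss:
  "loss_at l Y (kalman_predictor S P) d \<omega> = window_loss l S P d (\<lambda>m. Y (int (d + 1) + m) \<omega>)"
  by (subst window_loss_eq[of d "d + 1" l S P "\<lambda>i. Y i \<omega>"])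
    (simp_all add: loss_at_def kalman_predictor_def)

lemma window_loss_windowed:
  fixes l :: "real^'p \<Rightarrow> real"
  assumes "is_norm l"
  shows "window_loss l S P d \<in> borel_measurable (path_space {- int d..0})"
    and "window_loss l S P d (restrict y {- int d..0}) = window_loss l S P d y"
proof -
  have mult: "(\<lambda>x. A *v x) \<in> borel_measurable borel" for A :: "real^'p^'p"
    by (intro borel_measurable_continuous_onI linear_continuous_on matrix_vector_mul_bounded_linear)
  have component: "(\<lambda>y. y i) \<in> borel_measurable (path_space {- int d..0})"
    if "i \<in> {- int d..0}" for i
    unfolding path_space_def using that by (rule measurable_component_singleton)
  have "(\<lambda>y. kalman_coeff S P (d + 1) j *v y (int j - int d - 1))
      \<in> borel_measurable (path_space {- int d..0})" if "j \<in> {1..d}" for j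
    by (rule measurable_compose[OF component mult]) (use that in auto)
  then show "window_loss l S P d \<in> borel_measurable (path_space {- int d..0})"
    unfolding window_loss_def[abs_def] truncated_predictor_def
    by (intro measurable_compose[OF _ is_norm_measurable[OF assms]] borel_measurable_diff
        borel_measurable_sum component) auto
  show "window_loss l S P d (restrict y {- int d..0}) = window_loss l S P d y"
    by (auto simp: window_loss_def truncated_predictor_def intro!: arg_cong[where f = l] sum.cong)
qed

text \<open>The first part of the truncation gap turns the losses of the full predictor into those of the truncated
  one, its second part is constant.\<close>

lemma training_error_plus_gap:
  "training_error l Y d n (kalman_predictor S P) \<omega> + truncation_gap \<Omega> l Y S P d n \<omega>
    = 1 / real (n - d) * (\<Sum>i=d+1..n. window_loss l S P d (\<lambda>m. Y (int i + m) \<omega>))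
      + (\<integral>\<omega>'. l (Y 1 \<omega>') \<partial>\<Omega>) * (\<Sum>j=1..n-d. induced_norm l (kalman_coeff S P (n + 1) j))"
proof -
  have "loss_at l Y (kalman_predictor S P) (i - 1) \<omega>
      + (l (Y (int i) \<omega> - (\<Sum>j=i-d..i-1. kalman_coeff S P i j *v Y (int j) \<omega>))
        - l (Y (int i) \<omega> - (\<Sum>j=1..i-1. kalman_coeff S P i j *v Y (int j) \<omega>)))
      = window_loss l S P d (\<lambda>m. Y (int i + m) \<omega>)" if "i \<in> {d+1..n}" for i
    using that window_loss_eq[of d i l S P "\<lambda>i. Y i \<omega>"] by (simp add: loss_at_def kalman_predictor_def)
  then show ?thesis
    unfolding training_error_def truncation_gap_def add.assoc[symmetric] distrib_left[symmetric]
      sum.distrib[symmetric]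
    by simp
qed

context stationary_process
begin

lemma distr_Y: "distr \<Omega> borel (Y i) = distr \<Omega> borel (Y j)"
proof -
  have "(\<lambda>y. y 0) \<in> borel_measurable (path_space UNIV)"
    by (simp add: path_space_def)
  from distr_shift[OF this, of i] distr_shift[OF this, of j] show ?thesis
    by simp
qed

lemma integral_marginal:
  fixes f :: "'v \<Rightarrow> real"
  assumes [measurable]: "f \<in> borel_measurable borel"
    and int: "integrable \<Omega> (\<lambda>\<omega>. f (Y 1 \<omega>))"
  shows "integrable \<Omega> (\<lambda>\<omega>. f (Y i \<omega>))"
    and "expectation (\<lambda>\<omega>. f (Y i \<omega>)) = expectation (\<lambda>\<omega>. f (Y 1 \<omega>))"
proof -
  have eq: "integrable \<Omega> (\<lambda>\<omega>. f (Y i \<omega>)) \<longleftrightarrow> integrable (distr \<Omega> borel (Y i)) f"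
    "expectation (\<lambda>\<omega>. f (Y i \<omega>)) = integral\<^sup>L (distr \<Omega> borel (Y i)) f" for i
    by (simp_all add: integrable_distr_eq integral_distr)
  show "integrable \<Omega> (\<lambda>\<omega>. f (Y i \<omega>))" "expectation (\<lambda>\<omega>. f (Y i \<omega>)) = expectation (\<lambda>\<omega>. f (Y 1 \<omega>))"
    using int unfolding eq distr_Y[of i 1] by simp_all
qed

end

text \<open>Markov's inequality in a form that also covers the scale \<open>r = 0\<close>, where \<open>W\<close> vanishes almost surely.\<close>

lemma (in prob_space) prob_le_of_expectation:
  fixes W :: "'a \<Rightarrow> real"
  assumes int: "integrable M W" and nonneg: "\<And>\<omega>. 0 \<le> W \<omega>"
    and le: "expectation W \<le> K * r" "0 \<le> K" "0 \<le> r" and \<epsilon>: "0 < \<epsilon>"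
  shows "prob {\<omega>\<in>space M. (K + 1) / \<epsilon> * r < W \<omega>} < \<epsilon>"
proof (cases "r = 0")
  case True
  have "0 \<le> expectation W"
    by (intro Bochner_Integration.integral_nonneg nonneg)
  then have "expectation W = 0"
    using le(1) True by simp
  then have "AE \<omega> in M. W \<omega> = 0"
    using integral_nonneg_eq_0_iff_AE[OF int] nonneg by simp
  moreover have "{\<omega>\<in>space M. 0 < W \<omega>} \<in> events"
    using int by measurable
  ultimately have "prob {\<omega>\<in>space M. 0 < W \<omega>} = 0"
    by (subst prob_eq_0) (auto elim: eventually_mono)
  then show ?thesis
    using True \<epsilon> by simp
next
  case False
  then have r: "0 < r"
    using le by simp
  let ?c = "(K + 1) / \<epsilon> * r"
  have c: "0 < ?c"
    using r le \<epsilon> by simp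
  have [measurable]: "W \<in> borel_measurable M"
    using int by simp
  have "prob {\<omega>\<in>space M. ?c < W \<omega>} \<le> prob {\<omega>\<in>space M. W \<omega> \<ge> ?c}"
    by (intro finite_measure_mono) auto
  also have "\<dots> \<le> expectation W / ?c"
    using int nonneg c by (intro integral_Markov_inequality_measure) auto
  also have "\<dots> \<le> K * r / ?c"
    using le c by (intro divide_right_mono) auto
  also have "K * r / ?c = K / (K + 1) * \<epsilon>"
    using r by simp
  also have "\<dots> < \<epsilon>"
    using \<epsilon> le(2) by (simp add: pos_divide_less_eq)
  finally show ?thesis .
qed

text \<open>The rate \<open>r\<close> is kept abstract, to be instantiated by both growth estimates for the powers of the closed
  loop matrix. The two parts of the gap are dominated in mean by the same tail sum of coefficients.\<close>

lemma truncation_gap_bigO: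
  fixes S :: "('m::finite, 'p::finite, 'r::finite) state_space" and l :: "real^'p \<Rightarrow> real"
  assumes "stationary_process \<Omega> Y" and l: "is_norm l"
    and int: "integrable \<Omega> (\<lambda>\<omega>. l (Y 1 \<omega>))"
    and growth: "\<exists>C\<ge>0. \<forall>k\<ge>N. \<forall>w. norm (matrix_power (closed_loop S P) k *v w) \<le> C * r k * norm w"
    and r: "\<And>k. 0 \<le> r k"
    and tail: "\<exists>C\<ge>0. \<forall>d\<ge>1. \<forall>n. (\<Sum>k=d..<n. r k) \<le> C * r d"
  shows "bigO_prob \<Omega> (truncation_gap \<Omega> l Y S P) r"
proof -
  interpret stationary_process \<Omega> Y by fact
  note [measurable] = is_norm_measurable[OF l]
  have l_nonneg: "0 \<le> l x" for x
    using l by (simp add: is_norm_def)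
  define m where "m = expectation (\<lambda>\<omega>. l (Y 1 \<omega>))"
  have m: "0 \<le> m"
    unfolding m_def by (intro Bochner_Integration.integral_nonneg l_nonneg)
  have marginal: "integrable \<Omega> (\<lambda>\<omega>. l (Y i \<omega>))" "expectation (\<lambda>\<omega>. l (Y i \<omega>)) = m" for i
    using integral_marginal[of l i] int by (simp_all add: m_def)
  obtain D where D: "0 \<le> D" "\<And>i j. j + N < i \<Longrightarrow> induced_norm l (kalman_coeff S P i j) \<le> D * r (i - j - 1)"
    using kalman_coeff_bound[of l N S P r] l growth r by blast
  obtain C where C: "0 \<le> C" "\<And>d n. 1 \<le> d \<Longrightarrow> (\<Sum>k=d..<n. r k) \<le> C * r d"
    using tail by blast
  define s where "s i j = induced_norm l (kalman_coeff S P i j)" for i j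
  have s_nonneg: "0 \<le> s i j" for i j
    unfolding s_def by (rule induced_norm_bounds(2)[OF l])
  have s_sum: "(\<Sum>j=1..i-d-1. s i j) \<le> D * C * r d" if "max 1 N \<le> d" "d < i" for i d
  proof -
    have "(\<Sum>j=1..i-d-1. s i j) \<le> (\<Sum>j=1..i-d-1. D * r (i - j - 1))"
      unfolding s_def using that by (intro sum_mono D(2)) auto
    also have "\<dots> = D * (\<Sum>k=d..<i-1. r k)"
      unfolding sum_distrib_left
      by (rule sum.reindex_bij_witness[where i = "\<lambda>k. i - 1 - k" and j = "\<lambda>j. i - j - 1"])
        (use that in auto)
    also have "\<dots> \<le> D * (C * r d)"
      using that D(1) by (intro mult_left_mono C(2)) auto
    finally show ?thesis
      by (simp add: mult.assoc)
  qed
  define K where "K = 2 * m * D * C"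
  define W where "W d n \<omega> = 1 / real (n - d) * (\<Sum>i=d+1..n. \<Sum>j=1..i-d-1. s i j * l (Y (int j) \<omega>))
      + m * (\<Sum>j=1..n-d. s (n + 1) j)" for d n \<omega>
  have gap_le: "\<bar>truncation_gap \<Omega> l Y S P d n \<omega>\<bar> \<le> W d n \<omega>" for d n \<omega>
  proof -
    have "\<bar>truncation_gap \<Omega> l Y S P d n \<omega>\<bar> \<le> 1 / real (n - d) * (\<Sum>i=d+1..n.
          \<bar>l (Y (int i) \<omega> - (\<Sum>j=i-d..i-1. kalman_coeff S P i j *v Y (int j) \<omega>))
        - l (Y (int i) \<omega> - (\<Sum>j=1..i-1. kalman_coeff S P i j *v Y (int j) \<omega>))\<bar>)
        + m * (\<Sum>j=1..n-d. s (n + 1) j)"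
      unfolding truncation_gap_def m_def[symmetric] s_def[symmetric]
    proof (intro order_trans[OF abs_triangle_ineq] add_mono)
      have "0 \<le> m * (\<Sum>j=1..n-d. s (n + 1) j)"
        by (intro mult_nonneg_nonneg m sum_nonneg s_nonneg)
      then show "\<bar>m * (\<Sum>j=1..n-d. s (n + 1) j)\<bar> \<le> m * (\<Sum>j=1..n-d. s (n + 1) j)"
        by (simp only: abs_of_nonneg order_refl)
      show "\<bar>1 / real (n - d) * (\<Sum>i=d+1..n. f i)\<bar> \<le> 1 / real (n - d) * (\<Sum>i=d+1..n. \<bar>f i\<bar>)"
        for f :: "nat \<Rightarrow> real"
        unfolding abs_mult by (intro mult_mono sum_abs) auto
    qed
    also have "\<dots> \<le> W d n \<omega>"
      unfolding W_def s_def
      by (intro add_right_mono mult_left_mono sum_mono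
          truncation_loss_difference[OF l, of d _ "\<lambda>i. Y (int i) \<omega>" S P]) auto
    finally show ?thesis .
  qed
  have W_nonneg: "0 \<le> W d n \<omega>" for d n \<omega>
    using gap_le[of d n \<omega>] by linarith
  have int_W: "integrable \<Omega> (W d n)" for d n
    unfolding W_def using marginal by simp
  have W_le: "expectation (W d n) \<le> K * r d" if "max 1 N \<le> d \<and> d < n" for d n
  proof -
    have inner: "integrable \<Omega> (\<lambda>\<omega>. \<Sum>j=1..i-d-1. s i j * l (Y (int j) \<omega>))"
      "expectation (\<lambda>\<omega>. \<Sum>j=1..i-d-1. s i j * l (Y (int j) \<omega>)) = m * (\<Sum>j=1..i-d-1. s i j)" for i
    proof -
      show "integrable \<Omega> (\<lambda>\<omega>. \<Sum>j=1..i-d-1. s i j * l (Y (int j) \<omega>))"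
        by (intro Bochner_Integration.integrable_sum integrable_mult_right marginal)
      have "expectation (\<lambda>\<omega>. \<Sum>j=1..i-d-1. s i j * l (Y (int j) \<omega>))
          = (\<Sum>j=1..i-d-1. expectation (\<lambda>\<omega>. s i j * l (Y (int j) \<omega>)))"
        by (intro Bochner_Integration.integral_sum integrable_mult_right marginal)
      then show "expectation (\<lambda>\<omega>. \<Sum>j=1..i-d-1. s i j * l (Y (int j) \<omega>)) = m * (\<Sum>j=1..i-d-1. s i j)"
        by (simp only: integral_mult_right_zero marginal sum_distrib_left mult.commute)
    qed
    have outer: "integrable \<Omega> (\<lambda>\<omega>. 1 / real (n - d) * (\<Sum>i=d+1..n. \<Sum>j=1..i-d-1. s i j * l (Y (int j) \<omega>)))"
      by (intro integrable_mult_right Bochner_Integration.integrable_sum inner)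
    have "expectation (W d n) = expectation (\<lambda>\<omega>. 1 / real (n - d)
          * (\<Sum>i=d+1..n. \<Sum>j=1..i-d-1. s i j * l (Y (int j) \<omega>)))
        + m * (\<Sum>j=1..n-d. s (n + 1) j)"
      unfolding W_def Bochner_Integration.integral_add[OF outer integrable_const]
        lebesgue_integral_const prob_space scaleR_one ..
    also have "\<dots> = 1 / real (n - d) * (\<Sum>i=d+1..n. m * (\<Sum>j=1..i-d-1. s i j))
        + m * (\<Sum>j=1..n-d. s (n + 1) j)"
      by (simp only: integral_mult_right_zero Bochner_Integration.integral_sum inner)
    also have "\<dots> \<le> 1 / real (n - d) * (\<Sum>i=d+1..n. m * (D * C * r d)) + m * (D * C * r d)"
    proof (intro add_mono mult_left_mono sum_mono m)
      show "(\<Sum>j=1..i-d-1. s i j) \<le> D * C * r d" if "i \<in> {d+1..n}" for i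
        using that \<open>max 1 N \<le> d \<and> d < n\<close> by (intro s_sum) auto
      show "(\<Sum>j=1..n-d. s (n + 1) j) \<le> D * C * r d"
        using s_sum[of d "n + 1"] \<open>max 1 N \<le> d \<and> d < n\<close> by simp
    qed simp
    also have "\<dots> = K * r d"
    proof -
      have "real (n - d) \<noteq> 0"
        using that by simp
      then have "1 / real (n - d) * (real (n - d) * (m * (D * C * r d))) = m * (D * C * r d)"
        by simp
      then show ?thesis
        by (simp add: K_def)
    qed
    finally show ?thesis .
  qed
  have K: "0 \<le> K"
    unfolding K_def using m D C by simp
  show ?thesis
    unfolding bigO_prob_def
  proof (intro allI impI)
    fix \<epsilon> :: real assume \<epsilon>: "0 < \<epsilon>"
    have "prob {\<omega>\<in>space \<Omega>. \<bar>truncation_gap \<Omega> l Y S P d n \<omega>\<bar> > (K + 1) / \<epsilon> * \<bar>r d\<bar>} < \<epsilon>"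
      if "max 1 N \<le> d \<and> d < n" for d n
    proof -
      have [measurable]: "W d n \<in> borel_measurable \<Omega>"
        using int_W by simp
      have "prob {\<omega>\<in>space \<Omega>. \<bar>truncation_gap \<Omega> l Y S P d n \<omega>\<bar> > (K + 1) / \<epsilon> * \<bar>r d\<bar>}
          \<le> prob {\<omega>\<in>space \<Omega>. (K + 1) / \<epsilon> * r d < W d n \<omega>}"
        using gap_le[of d n] r[of d] by (intro finite_measure_mono) (auto intro: less_le_trans)
      also have "\<dots> < \<epsilon>"
        using that by (intro prob_le_of_expectation[OF int_W W_nonneg W_le K r \<epsilon>]) auto
      finally show ?thesis .
    qed
    then show "\<exists>C d0. \<forall>d n. d0 \<le> d \<and> d < n \<longrightarrow>
        prob {\<omega>\<in>space \<Omega>. \<bar>truncation_gap \<Omega> l Y S P d n \<omega>\<bar> > C * \<bar>r d\<bar>} < \<epsilon>"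
      by blast
  qed
qed

section \<open>Risk bound and rate of the truncation gap\<close>

lemma windowed_process_window_loss:
  fixes l :: "real^'p \<Rightarrow> real" and S :: "('m::finite, 'p::finite, 'r::finite) state_space"
  assumes "stationary_process \<Omega> Y" "is_norm l"
  shows "windowed_process \<Omega> Y (window_loss l S P d) d"
  using assms window_loss_windowed[OF assms(2)]
  by (intro windowed_process.intro windowed_process_axioms.intro)

text \<open>The forgotten terms cost at most \<open>\<Sum>j. l\<^sup>*(s\<^bsub>n+1,j\<^esub>) E[l (Y j)]\<close>, and \<open>E[l (Y j)] = E[l (Y 1)]\<close>.\<close>

lemma risk_le_truncated_risk:
  fixes S :: "('m::finite, 'p::finite, 'r::finite) state_space" and l :: "real^'p \<Rightarrow> real"
  assumes proc: "stationary_process \<Omega> Y" and l: "is_norm l"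
    and int: "integrable \<Omega> (\<lambda>\<omega>. l (Y 1 \<omega>))"
    and loss: "integrable \<Omega> (loss_at l Y (kalman_predictor S P) n)"
    and trunc: "integrable \<Omega> (\<lambda>\<omega>. window_loss l S P d (\<lambda>m. Y (int (n + 1) + m) \<omega>))"
    and d: "d \<le> n"
  shows "risk \<Omega> l Y n (kalman_predictor S P)
    \<le> (\<integral>\<omega>. window_loss l S P d (\<lambda>m. Y (int (n + 1) + m) \<omega>) \<partial>\<Omega>)
      + (\<integral>\<omega>. l (Y 1 \<omega>) \<partial>\<Omega>) * (\<Sum>j=1..n-d. induced_norm l (kalman_coeff S P (n + 1) j))"
proof -
  interpret stationary_process \<Omega> Y by fact
  note marginal = integral_marginal[OF is_norm_measurable[OF l] int]
  let ?s = "\<lambda>j. induced_norm l (kalman_coeff S P (n + 1) j)"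
  have int_sum: "integrable \<Omega> (\<lambda>\<omega>. \<Sum>j=1..n-d. ?s j * l (Y (int j) \<omega>))"
    by (intro Bochner_Integration.integrable_sum integrable_mult_right marginal)
  have "risk \<Omega> l Y n (kalman_predictor S P)
      \<le> expectation (\<lambda>\<omega>. window_loss l S P d (\<lambda>m. Y (int (n + 1) + m) \<omega>)
          + (\<Sum>j=1..n-d. ?s j * l (Y (int j) \<omega>)))"
    unfolding risk_def
  proof (rule integral_mono[OF loss Bochner_Integration.integrable_add[OF trunc int_sum]])
    fix \<omega>
    show "loss_at l Y (kalman_predictor S P) n \<omega> \<le> window_loss l S P d (\<lambda>m. Y (int (n + 1) + m) \<omega>)
        + (\<Sum>j=1..n-d. ?s j * l (Y (int j) \<omega>))"
      using truncation_loss_difference[OF l, of d "n + 1" "\<lambda>i. Y (int i) \<omega>" S P] d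
        window_loss_eq[of d "n + 1" l S P "\<lambda>i. Y i \<omega>"]
      by (simp add: loss_at_def kalman_predictor_def)
  qed
  also have "\<dots> = expectation (\<lambda>\<omega>. window_loss l S P d (\<lambda>m. Y (int (n + 1) + m) \<omega>))
      + (\<Sum>j=1..n-d. ?s j * expectation (\<lambda>\<omega>. l (Y 1 \<omega>)))"
    unfolding Bochner_Integration.integral_add[OF trunc int_sum]
    by (subst Bochner_Integration.integral_sum)
      (simp_all only: integral_mult_right_zero marginal(1) marginal(2)[of "int _"] integrable_mult_right)
  finally show ?thesis
    by (simp only: sum_distrib_left mult.commute)
qed

text \<open>A nonempty class picks at least one subset from any \<open>n\<close> points. The bound by \<open>2 ^ n\<close> is needed since
  the supremum of an unbounded set of natural numbers is not an upper bound.\<close>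

lemma loss_growth_ge_1:
  fixes l :: "real^'p \<Rightarrow> real"
  assumes "F \<noteq> {}"
  shows "1 \<le> loss_growth l d F n"
proof -
  let ?V = "windows d \<times> UNIV \<times> UNIV :: ((nat \<Rightarrow> real^'p) \<times> (real^'p) \<times> real) set"
  let ?C = "loss_subgraph l d ` F"
  let ?N = "\<lambda>A. card {A \<inter> C |C. C \<in> ?C}"
  have traces: "{A \<inter> C |C. C \<in> ?C} \<subseteq> Pow A" for A
    by auto
  have "windows d \<noteq> ({} :: (nat \<Rightarrow> real^'p) set)"
    by (simp add: windows_def PiE_eq_empty_iff)
  then have "infinite ?V"
    by (auto simp: finite_cartesian_product_iff finite_prod infinite_UNIV_char_0)
  then obtain A where A: "A \<subseteq> ?V" "finite A" "card A = n"
    using infinite_arbitrarily_large[of ?V n] by auto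
  have "finite {A \<inter> C |C. C \<in> ?C}"
    by (rule finite_subset[OF traces]) (simp add: A(2))
  moreover have "{A \<inter> C |C. C \<in> ?C} \<noteq> {}"
    using assms by auto
  ultimately have "1 \<le> ?N A"
    by (simp add: Suc_le_eq card_gt_0_iff)
  also have "?N A \<le> loss_growth l d F n"
    unfolding loss_growth_def growth_function_def
  proof (rule cSUP_upper)
    show "bdd_above (?N ` {A. A \<subseteq> ?V \<and> finite A \<and> card A = n})"
    proof (rule bdd_aboveI2)
      fix B assume "B \<in> {A. A \<subseteq> ?V \<and> finite A \<and> card A = n}"
      then have "finite (Pow B)" "card (Pow B) = 2 ^ n"
        by (simp_all add: card_Pow)
      then show "?N B \<le> 2 ^ n"
        using card_mono[OF _ traces[of B]] by simp
    qed
  qed (use A in simp)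
  finally show ?thesis .
qed

text \<open>Here \<open>\<tau>\<^sup>2 / M\<^sup>2 = exp 4 * E * (4 - ln E) / 2 \<ge> E / 2\<close>, and \<open>\<mu> * E / 4 \<ge> ln (8 / \<eta>)\<close> because
  \<open>ln g \<ge> 0\<close>. The exponential is therefore at most \<open>\<eta> / 8\<close>.\<close>

lemma deviation_tail_le:
  fixes \<mu> :: nat and g :: nat
  assumes "0 < \<mu>" "1 \<le> g" "0 < \<eta>" "\<eta> < 1" "0 < M"
  defines "E \<equiv> complexity_term g \<mu> \<eta>"
  assumes "exp (- 4) \<le> 4 - ln E"
  defines "\<tau> \<equiv> M * (exp 1)\<^sup>2 * sqrt (E * (4 - ln E) / 2)"
  shows "0 \<le> \<tau>" and "2 * exp (- (real \<mu> * \<tau>\<^sup>2 / (2 * M\<^sup>2))) \<le> \<eta>"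
proof -
  have "0 < ln (8 / \<eta>)"
    using assms(3,4) by simp
  moreover have "0 \<le> ln (real g)"
    using assms(2) by simp
  moreover have "real \<mu> * E = 4 * ln (real g) + 4 * ln (8 / \<eta>)"
    using assms(1) by (simp add: E_def complexity_term_def)
  ultimately have E: "0 < real \<mu> * E" "4 * ln (8 / \<eta>) \<le> real \<mu> * E"
    by linarith+
  then have E_pos: "0 < E"
    by (simp add: zero_less_mult_iff)
  have "0 < 4 - ln E"
    by (rule less_le_trans[OF exp_gt_zero assms(7)])
  with E_pos have root: "0 \<le> E * (4 - ln E) / 2"
    by simp
  then show "0 \<le> \<tau>"
    unfolding \<tau>_def using assms(5) by (intro mult_nonneg_nonneg real_sqrt_ge_zero) simp_all
  have exp4: "exp 1 ^ 4 = (exp 4 :: real)"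
    using exp_of_nat_mult[of 4 "1 :: real"] by simp
  have "1 = exp 4 * exp (- 4 :: real)"
    by (simp flip: exp_add)
  also have "\<dots> \<le> exp 4 * (4 - ln E)"
    using assms(7) by (intro mult_left_mono) auto
  finally have "E * 1 \<le> E * (exp 4 * (4 - ln E))"
    using E_pos by (intro mult_left_mono) auto
  moreover have "\<tau>\<^sup>2 / (2 * M\<^sup>2) = E * (exp 4 * (4 - ln E)) / 4"
    using assms(5) by (simp add: \<tau>_def power_mult_distrib real_sqrt_pow2[OF root] exp4)
  ultimately have "E / 4 \<le> \<tau>\<^sup>2 / (2 * M\<^sup>2)"
    by simp
  then have "real \<mu> * (E / 4) \<le> real \<mu> * (\<tau>\<^sup>2 / (2 * M\<^sup>2))"
    by (intro mult_left_mono) auto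
  moreover have "real \<mu> * (E / 4) = real \<mu> * E / 4"
    "real \<mu> * (\<tau>\<^sup>2 / (2 * M\<^sup>2)) = real \<mu> * \<tau>\<^sup>2 / (2 * M\<^sup>2)"
    by simp_all
  ultimately have "ln (8 / \<eta>) \<le> real \<mu> * \<tau>\<^sup>2 / (2 * M\<^sup>2)"
    using E(2) by linarith
  then have "exp (- (real \<mu> * \<tau>\<^sup>2 / (2 * M\<^sup>2))) \<le> exp (- ln (8 / \<eta>))"
    by simp
  also have "\<dots> = \<eta> / 8"
    using assms(3) by (simp add: exp_minus)
  finally show "2 * exp (- (real \<mu> * \<tau>\<^sup>2 / (2 * M\<^sup>2))) \<le> \<eta>"
    using assms(3) by simp
qed

text \<open>For \<open>\<eta> \<ge> 1\<close> there is nothing to prove. For \<open>M = 0\<close>, where the Chernoff parameter \<open>\<tau> / M\<^sup>2\<close> is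
  meaningless, the truncated loss vanishes almost surely. Otherwise the block tail bound applies
  to the complement of the event.\<close>

lemma risk_bound:
  fixes S :: "('m::finite, 'p::finite, 'r::finite) state_space" and l :: "real^'p \<Rightarrow> real"
    and \<mu> a d n g :: nat and \<eta> M :: real
  assumes proc: "stationary_process \<Omega> Y" and l: "is_norm l"
    and int: "integrable \<Omega> (\<lambda>\<omega>. l (Y 1 \<omega>))"
    and moment: "\<And>k. 1 \<le> k \<Longrightarrow> integrable \<Omega> (\<lambda>\<omega>. (loss_at l Y (kalman_predictor S P) k \<omega>)\<^sup>2) \<and>
      sqrt (\<integral>\<omega>. (loss_at l Y (kalman_predictor S P) k \<omega>)\<^sup>2 \<partial>\<Omega>) \<le> M"
    and d: "1 \<le> d" "d < n" "d < a" "2 * \<mu> * a + d = n"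
    and g: "1 \<le> g"
  defines "\<eta>' \<equiv> \<eta> - 2 * real \<mu> * beta_coeff \<Omega> Y (a - d)"
  defines "E \<equiv> complexity_term g \<mu> \<eta>'"
  assumes \<eta>': "0 < \<eta>'" and E: "exp (- 4) \<le> 4 - ln E"
  shows "1 - \<eta> \<le> measure \<Omega> {\<omega>\<in>space \<Omega>. risk \<Omega> l Y n (kalman_predictor S P)
    \<le> training_error l Y d n (kalman_predictor S P) \<omega> + truncation_gap \<Omega> l Y S P d n \<omega>
      + M * (exp 1)\<^sup>2 * sqrt (E * (4 - ln E) / 2)}"
proof -
  let ?f = "kalman_predictor S P" and ?\<beta> = "beta_coeff \<Omega> Y (a - d)"
  interpret windowed_process \<Omega> Y "window_loss l S P d" d
    by (intro windowed_process_window_loss proc l)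
  define \<tau> where "\<tau> = M * (exp 1)\<^sup>2 * sqrt (E * (4 - ln E) / 2)"
  define R where "R = expectation (window_at 0)"
  define A where "A \<omega> = 1 / real (n - d) * (\<Sum>i=d+1..n. window_at i \<omega>)" for \<omega>
  have [measurable]: "A \<in> borel_measurable \<Omega>"
    unfolding A_def by measurable
  have \<mu>: "0 < \<mu>"
    using d by (cases "\<mu> = 0") auto
  have loss_eq: "loss_at l Y ?f d = window_at (d + 1)"
    by (simp add: window_at_def loss_at_eq_window_loss fun_eq_iff)
  have transfer: "integrable \<Omega> (\<lambda>\<omega>. h (window_at i \<omega>)) \<longleftrightarrow> integrable \<Omega> (\<lambda>\<omega>. h (window_at j \<omega>))"
    "expectation (\<lambda>\<omega>. h (window_at i \<omega>)) = expectation (\<lambda>\<omega>. h (window_at j \<omega>))"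
    if h: "h \<in> borel_measurable borel" for h :: "real \<Rightarrow> real" and i j
  proof -
    have "integrable \<Omega> (\<lambda>\<omega>. h (window_at i \<omega>)) \<longleftrightarrow> integrable (distr \<Omega> borel (window_at i)) h"
      "expectation (\<lambda>\<omega>. h (window_at i \<omega>)) = integral\<^sup>L (distr \<Omega> borel (window_at i)) h" for i
      using h by (simp_all add: integrable_distr_eq integral_distr)
    then show "integrable \<Omega> (\<lambda>\<omega>. h (window_at i \<omega>)) \<longleftrightarrow> integrable \<Omega> (\<lambda>\<omega>. h (window_at j \<omega>))"
      "expectation (\<lambda>\<omega>. h (window_at i \<omega>)) = expectation (\<lambda>\<omega>. h (window_at j \<omega>))"
      by (simp_all only: distr_window_at[of i j])
  qed
  have sq: "(\<lambda>x::real. x\<^sup>2) \<in> borel_measurable borel"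
    and ident: "(\<lambda>x::real. x) \<in> borel_measurable borel"
    by measurable
  have "integrable \<Omega> (\<lambda>\<omega>. (window_at (d + 1) \<omega>)\<^sup>2)" "sqrt (expectation (\<lambda>\<omega>. (window_at (d + 1) \<omega>)\<^sup>2)) \<le> M"
    using moment[OF d(1)] by (simp_all add: loss_eq)
  then have int2: "integrable \<Omega> (\<lambda>\<omega>. (window_at 0 \<omega>)\<^sup>2)" and sqrt_M: "sqrt (expectation (\<lambda>\<omega>. (window_at 0 \<omega>)\<^sup>2)) \<le> M"
    by (simp_all only: transfer[OF sq, of 0 "d + 1"])
  have M: "0 \<le> M"
    using order_trans[OF _ sqrt_M] by simp
  have mom: "expectation (\<lambda>\<omega>. (window_at 0 \<omega>)\<^sup>2) \<le> M\<^sup>2"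
    using sqrt_le_D[OF sqrt_M] .
  have nonneg: "0 \<le> window_loss l S P d y" for y
    using l by (simp add: window_loss_def is_norm_def)
  then have window_at_nonneg: "0 \<le> window_at i \<omega>" for i \<omega>
    by (simp add: window_at_def)
  have intX: "integrable \<Omega> (window_at i)" for i
    using integrable_window_at[OF nonneg int2 mom] transfer(1)[OF ident, of i 0] by blast
  have risk: "risk \<Omega> l Y n ?f \<le> R + expectation (\<lambda>\<omega>. l (Y 1 \<omega>))
      * (\<Sum>j=1..n-d. induced_norm l (kalman_coeff S P (n + 1) j))"
  proof -
    have meas: "loss_at l Y ?f n \<in> borel_measurable \<Omega>"
    proof -
      interpret full: windowed_process \<Omega> Y "window_loss l S P n" n
        by (intro windowed_process_window_loss proc l)
      have "loss_at l Y ?f n = full.window_at (n + 1)"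
        by (simp add: full.window_at_def loss_at_eq_window_loss fun_eq_iff)
      then show ?thesis
        using full.measurable_window_at[of "n + 1"] by (simp only:)
    qed
    have "1 \<le> n"
      using d by simp
    then have loss_int: "integrable \<Omega> (loss_at l Y ?f n)"
      using moment square_integrable_imp_integrable[OF meas] by blast
    have trunc_int: "integrable \<Omega> (\<lambda>\<omega>. window_loss l S P d (\<lambda>m. Y (int (n + 1) + m) \<omega>))"
      using intX[of "n + 1"] unfolding window_at_def[abs_def] .
    show ?thesis
      using risk_le_truncated_risk[OF proc l int loss_int trunc_int]
        transfer(2)[OF ident, of "n + 1" 0] d(2)
      unfolding R_def window_at_def by simp
  qed
  have bound: "1 - \<eta> \<le> prob {\<omega>\<in>space \<Omega>. R \<le> A \<omega> + \<tau>}"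
  proof (cases "1 \<le> \<eta>")
    case True
    then show ?thesis
      using measure_nonneg[of \<Omega> "{\<omega>\<in>space \<Omega>. R \<le> A \<omega> + \<tau>}"] by linarith
  next
    case False
    have \<beta>: "0 \<le> 2 * real \<mu> * ?\<beta>"
      using beta_coeff_nonneg by simp
    then have \<eta>1: "\<eta>' < 1"
      using False unfolding \<eta>'_def by linarith
    show ?thesis
    proof (cases "M = 0")
      case True
      have "expectation (\<lambda>\<omega>. (window_at 0 \<omega>)\<^sup>2) = 0"
      proof (rule antisym)
        show "expectation (\<lambda>\<omega>. (window_at 0 \<omega>)\<^sup>2) \<le> 0"
          using mom True by simp
        show "0 \<le> expectation (\<lambda>\<omega>. (window_at 0 \<omega>)\<^sup>2)"
          by (intro Bochner_Integration.integral_nonneg) simp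
      qed
      then have "AE \<omega> in \<Omega>. (window_at 0 \<omega>)\<^sup>2 = 0"
        by (subst (asm) integral_nonneg_eq_0_iff_AE[OF int2]) simp_all
      then have "AE \<omega> in \<Omega>. window_at 0 \<omega> = 0"
        by eventually_elim simp
      then have "R = expectation (\<lambda>_. 0)"
        unfolding R_def by (intro integral_cong_AE) simp_all
      then have "R = 0"
        by simp
      moreover have "0 \<le> A \<omega>" for \<omega>
        unfolding A_def by (intro mult_nonneg_nonneg sum_nonneg window_at_nonneg) simp
      ultimately have "{\<omega>\<in>space \<Omega>. R \<le> A \<omega> + \<tau>} = space \<Omega>"
        using True by (auto simp: \<tau>_def)
      then show ?thesis
        using \<eta>' \<beta> by (simp add: prob_space \<eta>'_def)
    next
      case False
      then have "0 < M"
        using M by simp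
      note tail = deviation_tail_le[OF \<mu> g \<eta>' \<eta>1 \<open>0 < M\<close> E[unfolded E_def], folded E_def, folded \<tau>_def]
      have range: "2 * \<mu> * a = n - d" "{d + 1..<d + 1 + (n - d)} = {d + 1..n}"
        using d by auto
      have "prob {\<omega>\<in>space \<Omega>. A \<omega> < R - \<tau>}
          \<le> 2 * exp (- (real \<mu> * \<tau>\<^sup>2 / (2 * M\<^sup>2))) + 2 * real \<mu> * ?\<beta>"
        using lower_tail_training_average[OF nonneg int2 mom d(3) \<mu> tail(1) \<open>0 < M\<close>, of "d + 1"]
        unfolding A_def R_def by (simp only: range of_nat_mult of_nat_numeral)
      also have "\<dots> \<le> \<eta>"
        using tail(2) by (simp add: \<eta>'_def)
      finally have "prob {\<omega>\<in>space \<Omega>. A \<omega> < R - \<tau>} \<le> \<eta>" .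
      moreover have "{\<omega>\<in>space \<Omega>. R \<le> A \<omega> + \<tau>} = space \<Omega> - {\<omega>\<in>space \<Omega>. A \<omega> < R - \<tau>}"
        by auto
      ultimately show ?thesis
        using prob_compl[of "{\<omega>\<in>space \<Omega>. A \<omega> < R - \<tau>}"] by simp
    qed
  qed
  define B where "B = expectation (\<lambda>\<omega>. l (Y 1 \<omega>)) * (\<Sum>j=1..n-d. induced_norm l (kalman_coeff S P (n + 1) j))"
  have split: "training_error l Y d n ?f \<omega> + truncation_gap \<Omega> l Y S P d n \<omega> = A \<omega> + B" for \<omega>
    unfolding training_error_plus_gap A_def B_def window_at_def ..
  have "prob {\<omega>\<in>space \<Omega>. R \<le> A \<omega> + \<tau>} \<le> prob {\<omega>\<in>space \<Omega>. risk \<Omega> l Y n ?f \<le> A \<omega> + B + \<tau>}"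
    using risk unfolding B_def[symmetric] by (intro finite_measure_mono) auto
  then show ?thesis
    using bound unfolding split \<tau>_def by linarith
qed

theorem corollary16:
  fixes \<Omega> :: "'w measure"
    and Y :: "int \<Rightarrow> 'w \<Rightarrow> real^'p"
    and \<Theta> :: "'t set"
    and S :: "'t \<Rightarrow> ('m::finite, 'p::finite, 'r::finite) state_space"
    and P :: "'t \<Rightarrow> real^'m^'m"
    and l :: "real^'p \<Rightarrow> real"
    and M :: real
    and n d \<mu> a :: nat
    and \<theta> :: 't
  assumes "prob_space \<Omega>"
    and "\<And>i. Y i \<in> borel_measurable \<Omega>"
    and "stationary \<Omega> Y"
    and "beta_mixing \<Omega> Y"
    and "\<And>\<theta>. \<theta> \<in> \<Theta> \<Longrightarrow> pos_def (obs_cov (S \<theta>)) \<and> pos_def (state_cov (S \<theta>))"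
    and "\<And>\<theta>. \<theta> \<in> stable_params \<Theta> S \<Longrightarrow> riccati_solution (S \<theta>) (P \<theta>)"
    and "is_norm l"
    and "integrable \<Omega> (\<lambda>\<omega>. l (Y 1 \<omega>))"
    and "\<And>f k. f \<in> kalman_class \<Theta> S P \<Longrightarrow> 1 \<le> k \<Longrightarrow>
           integrable \<Omega> (\<lambda>\<omega>. (loss_at l Y f k \<omega>)\<^sup>2) \<and>
           sqrt (\<integral>\<omega>. (loss_at l Y f k \<omega>)\<^sup>2 \<partial>\<Omega>) \<le> M"
    and "1 \<le> d" and "d < n" and "d < a" and "2 * \<mu> * a + d = n"
    and "\<theta> \<in> stable_params \<Theta> S"
  shows "(\<forall>\<eta>. let f = kalman_predictor (S \<theta>) (P \<theta>);
                  \<eta>' = \<eta> - 2 * real \<mu> * beta_coeff \<Omega> Y (a - d);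
                  E = complexity_term (loss_growth l d (truncated_class \<Theta> S P d) n) \<mu> \<eta>'
              in \<eta> > 2 * real \<mu> * beta_coeff \<Omega> Y (a - d) \<longrightarrow>
                 4 - ln E \<ge> exp (- 4) \<longrightarrow>
                 measure \<Omega> {\<omega>\<in>space \<Omega>.
                   risk \<Omega> l Y n f \<le> training_error l Y d n f \<omega>
                     + truncation_gap \<Omega> l Y (S \<theta>) (P \<theta>) d n \<omega>
                     + M * (exp 1)\<^sup>2 * sqrt (E * (4 - ln E) / 2)} \<ge> 1 - \<eta>)
       \<and> (let \<rho> = lambda_max (closed_loop (S \<theta>) (P \<theta>));
              \<delta> = truncation_gap \<Omega> l Y (S \<theta>) (P \<theta>)
          in (dominant_semisimple (closed_loop (S \<theta>) (P \<theta>)) \<longrightarrow>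
                bigO_prob \<Omega> \<delta> (\<lambda>d. \<rho> ^ d))
             \<and> bigO_prob \<Omega> \<delta> (\<lambda>d. real d ^ (CARD('m) - 1) * \<rho> ^ d))"
  unfolding Let_def
proof (intro conjI allI impI)
  let ?S = "S \<theta>" and ?P = "P \<theta>"
  have proc: "stationary_process \<Omega> Y"
    using assms(1-3) by (intro stationary_process.intro stationary_process_axioms.intro)
  have moment: "integrable \<Omega> (\<lambda>\<omega>. (loss_at l Y (kalman_predictor ?S ?P) k \<omega>)\<^sup>2) \<and>
      sqrt (\<integral>\<omega>. (loss_at l Y (kalman_predictor ?S ?P) k \<omega>)\<^sup>2 \<partial>\<Omega>) \<le> M" if "1 \<le> k" for k
    using assms(14) that by (intro assms(9)) (auto simp: kalman_class_def)
  have growth: "1 \<le> loss_growth l d (truncated_class \<Theta> S P d) n"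
    using assms(14) by (intro loss_growth_ge_1) (auto simp: truncated_class_def)
  let ?\<eta>' = "\<lambda>\<eta>. \<eta> - 2 * real \<mu> * beta_coeff \<Omega> Y (a - d)"
  let ?E = "\<lambda>\<eta>. complexity_term (loss_growth l d (truncated_class \<Theta> S P d) n) \<mu> (?\<eta>' \<eta>)"
  fix \<eta>
  assume \<eta>: "2 * real \<mu> * beta_coeff \<Omega> Y (a - d) < \<eta>" and E: "exp (- 4) \<le> 4 - ln (?E \<eta>)"
  from \<eta> have "0 < ?\<eta>' \<eta>"
    by simp
  from risk_bound[OF proc assms(7,8) moment assms(10-13) growth this E]
  show "1 - \<eta> \<le> measure \<Omega> {\<omega>\<in>space \<Omega>.
      risk \<Omega> l Y n (kalman_predictor ?S ?P) \<le> training_error l Y d n (kalman_predictor ?S ?P) \<omega>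
        + truncation_gap \<Omega> l Y ?S ?P d n \<omega>
        + M * (exp 1)\<^sup>2 * sqrt (?E \<eta> * (4 - ln (?E \<eta>)) / 2)}"
    by blast
next
  let ?A = "closed_loop (S \<theta>) (P \<theta>)"
  let ?\<rho> = "lambda_max ?A"
  have proc: "stationary_process \<Omega> Y"
    using assms(1-3) by (intro stationary_process.intro stationary_process_axioms.intro)
  have \<rho>: "0 \<le> ?\<rho>" "?\<rho> < 1"
    using assms(5,6,14) by (auto simp: stable_params_def intro: closed_loop_stable lambda_max_nonneg)
  note bigO = truncation_gap_bigO[OF proc assms(7,8)]
  show "bigO_prob \<Omega> (truncation_gap \<Omega> l Y (S \<theta>) (P \<theta>)) (\<lambda>d. ?\<rho> ^ d)" if "dominant_semisimple ?A"
  proof (rule bigO[where N = 0])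
    show "\<exists>C\<ge>0. \<forall>k\<ge>0. \<forall>w. norm (matrix_power ?A k *v w) \<le> C * ?\<rho> ^ k * norm w"
      using matrix_power_bound_semisimple[OF that] by simp
    show "\<exists>C\<ge>0. \<forall>d\<ge>1. \<forall>n. (\<Sum>k=d..<n. ?\<rho> ^ k) \<le> C * ?\<rho> ^ d"
      using polynomial_geometric_tail[OF \<rho>, of 0] by simp
  qed (use \<rho> in simp)
  show "bigO_prob \<Omega> (truncation_gap \<Omega> l Y (S \<theta>) (P \<theta>)) (\<lambda>d. real d ^ (CARD('m) - 1) * ?\<rho> ^ d)"
    using matrix_power_bound[of ?A] polynomial_geometric_tail[OF \<rho>, of "CARD('m) - 1"] \<rho>
    by (intro bigO[where N = "CARD('m)"]) auto
qed

end
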